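(* Let $m\ge2$. For every $n\in\mathbb{N}$, $$\mathfrak{F}_n\le\left(\frac{n\cdot n!}{4^{n-1}}\right)^{1/n},$$ and in particular $\mathfrak{F}_3\le 3^{2/3}/2=1.04004\ldots$.
   Context: For a non-empty open $\Omega\subset\mathbb{R}^m$ with $|\Omega|<\infty$, $\lambda_1(\Omega)=\inf_{\varphi\in H_0^1(\Omega)\setminus\{0\}}\int_\Omega|D\varphi|^2/\int_\Omega\varphi^2$, $v_\Omega$ is the unique solution of $-\Delta v=1$, $v\in H_0^1(\Omega)$, $F_p(\Omega)=\|v_\Omega\|_{L^p(\Omega)}\lambda_1(\Omega)/|\Omega|^{1/p}$, and $\mathfrak{F}_p=\sup\{F_p(\Omega):\Omega\text{ open in }\mathbb{R}^m,\ 0<|\Omega|<\infty\}$. *)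

theory Defs
  imports "HOL-Analysis.Analysis"
begin

definition partial_deriv :: "(real^'m \<Rightarrow> real) \<Rightarrow> 'm \<Rightarrow> real^'m \<Rightarrow> real" where
  "partial_deriv f i x = frechet_derivative f (at x) (axis i 1)"

definition grad :: "(real^'m \<Rightarrow> real) \<Rightarrow> real^'m \<Rightarrow> real^'m" where
  "grad f x = (\<chi> i. partial_deriv f i x)"

fun Ck :: "nat \<Rightarrow> (real^'m \<Rightarrow> real) \<Rightarrow> bool" where
  "Ck 0 f = continuous_on UNIV f"
| "Ck (Suc k) f = ((\<forall>x. f differentiable (at x)) \<and> (\<forall>i. Ck k (partial_deriv f i)))"

definition smooth_fun :: "(real^'m \<Rightarrow> real) \<Rightarrow> bool" where
  "smooth_fun f = (\<forall>k. Ck k f)"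

definition tsupport :: "(real^'m \<Rightarrow> real) \<Rightarrow> (real^'m) set" where
  "tsupport f = closure {x. f x \<noteq> 0}"

definition test_fun :: "(real^'m) set \<Rightarrow> (real^'m \<Rightarrow> real) \<Rightarrow> bool" where
  "test_fun \<Omega> f = (smooth_fun f \<and> compact (tsupport f) \<and> tsupport f \<subseteq> \<Omega>)"

text \<open>H01 Omega phi G: \<phi> (a function on R^m, i.e. extended by zero outside \<Omega>)
  belongs to H_0^1(\<Omega>), the closure of C_c^\<infinity>(\<Omega>) in the H^1 norm, and G is its
  (weak) gradient: there are test functions \<phi>_k with \<phi>_k \<rightarrow> \<phi> and D\<phi>_k \<rightarrow> G in L^2.\<close>
definition H01 :: "(real^'m) set \<Rightarrow> (real^'m \<Rightarrow> real) \<Rightarrow> (real^'m \<Rightarrow> real^'m) \<Rightarrow> bool" where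
  "H01 \<Omega> \<phi> G = (\<phi> \<in> borel_measurable lebesgue \<and> G \<in> borel_measurable lebesgue \<and>
     (\<exists>\<psi> :: nat \<Rightarrow> real^'m \<Rightarrow> real. (\<forall>k. test_fun \<Omega> (\<psi> k)) \<and>
        (\<lambda>k. \<integral>\<^sup>+ x. ennreal ((\<psi> k x - \<phi> x)\<^sup>2) \<partial>lebesgue) \<longlonglongrightarrow> 0 \<and>
        (\<lambda>k. \<integral>\<^sup>+ x. ennreal ((norm (grad (\<psi> k) x - G x))\<^sup>2) \<partial>lebesgue) \<longlonglongrightarrow> 0))"

definition lambda1 :: "(real^'m) set \<Rightarrow> real" where
  "lambda1 \<Omega> = Inf {(\<integral>x\<in>\<Omega>. (norm (G x))\<^sup>2 \<partial>lebesgue) / (\<integral>x\<in>\<Omega>. (\<phi> x)\<^sup>2 \<partial>lebesgue)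
       | \<phi> G. H01 \<Omega> \<phi> G \<and> (\<integral>\<^sup>+x\<in>\<Omega>. ennreal ((\<phi> x)\<^sup>2) \<partial>lebesgue) \<noteq> 0}"

text \<open>Weak solution of -\<Delta>v = 1, v \<in> H_0^1(\<Omega>).\<close>
definition is_torsion :: "(real^'m) set \<Rightarrow> (real^'m \<Rightarrow> real) \<Rightarrow> bool" where
  "is_torsion \<Omega> v = (\<exists>G. H01 \<Omega> v G \<and>
     (\<forall>\<phi> H. H01 \<Omega> \<phi> H \<longrightarrow>
        (\<integral>x\<in>\<Omega>. G x \<bullet> H x \<partial>lebesgue) = (\<integral>x\<in>\<Omega>. \<phi> x \<partial>lebesgue)))"

text \<open>v_\<Omega> (unique up to null sets; any choice gives the same L^p norms).\<close>
definition torsion :: "(real^'m) set \<Rightarrow> real^'m \<Rightarrow> real" where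
  "torsion \<Omega> = (SOME v. is_torsion \<Omega> v)"

definition Lp_norm :: "real \<Rightarrow> (real^'m) set \<Rightarrow> (real^'m \<Rightarrow> real) \<Rightarrow> real" where
  "Lp_norm p \<Omega> v = (enn2real (\<integral>\<^sup>+x\<in>\<Omega>. ennreal (\<bar>v x\<bar> powr p) \<partial>lebesgue)) powr (1 / p)"

definition F_fun :: "real \<Rightarrow> (real^'m) set \<Rightarrow> real" where
  "F_fun p \<Omega> = Lp_norm p \<Omega> (torsion \<Omega>) * lambda1 \<Omega> / (measure lebesgue \<Omega>) powr (1 / p)"

text \<open>\<frak>F_p, the supremum over open sets of finite positive measure in R^m
  (taken in the extended reals, so that it is meaningful even if unbounded).
  The dimension m is the cardinality of the index type 'm.\<close>
definition frakF :: "('m::finite) itself \<Rightarrow> real \<Rightarrow> ereal" where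
  "frakF _ p = Sup {ereal (F_fun p (\<Omega> :: (real^'m) set)) | \<Omega>.
       open \<Omega> \<and> 0 < emeasure lebesgue \<Omega> \<and> emeasure lebesgue \<Omega> < \<infinity>}"

end

theory Submission
  imports Defs
begin

text \<open>
  Let \<open>v\<close> be the torsion function with gradient \<open>G\<close>. If \<open>g' = w\<close> and \<open>h' = w\<^sup>2\<close> with
  \<open>g 0 = h 0 = 0\<close>, then testing the Rayleigh quotient with \<open>g(v)\<close> and the torsion equation
  with \<open>h(v)\<close> gives \<open>\<lambda>\<^sub>1 \<integral> g(v)\<^sup>2 \<le> \<integral> w(v)\<^sup>2 |G|\<^sup>2 = \<integral> h(v)\<close>. Taking \<open>w(t)\<close> close to
  \<open>(n/2) |t|^(n/2 - 1)\<close> yields \<open>\<lambda>\<^sub>1 \<integral> |v|^n \<le> n\<^sup>2 / (4 (n - 1)) \<integral> |v|^(n - 1)\<close> without any sign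
  information on \<open>v\<close>. Iterating down to \<open>\<lambda>\<^sub>1 \<integral> |v| \<le> |\<Omega>|\<close>, which is Cauchy-Schwarz, gives the
  bound. If \<open>\<lambda>\<^sub>1 = 0\<close> there is nothing to prove; otherwise \<open>\<lambda>\<^sub>1 > 0\<close> is itself a Poincare
  inequality, and the torsion function exists as the limit of a minimizing sequence of
  \<open>\<integral> |D\<phi>|\<^sup>2 / 2 - \<integral> \<phi>\<close> over the test functions.
\<close>

section \<open>Square-integrable functions\<close>

text \<open>The weight must be smooth and bounded. Smoothness keeps a composed test function a test
  function, and boundedness lets the chain rule survive the L^2 limits that define
  \<open>H01\<close>. The power (n/2) |t|^(n/2 - 1) is in general not smooth at 0, for n > 2 it is
  unbounded, and v is not known to be bounded; hence a family of regularised weights. When the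
  regularisation is removed, the right side converges by dominated convergence and the left side is
  controlled by Fatou, so finiteness of the n-th moment is obtained rather than presupposed.

  In the constant, n^2/4 is the square of the factor n/2, and 1/(n - 1) comes from integrating t^(n
  - 2). The product of j^2 / (4 (j - 1)) over j = 2, ..., n is n n! / 4^(n - 1). No sign of v is
  needed because g(t)^2 grows in both directions, while h is nondecreasing with h(0) = 0 and hence
  nonpositive for t < 0. Existence matters because \<open>torsion\<close> is a \<open>SOME\<close>
  choice, about which nothing is known until a weak solution is exhibited.\<close>

definition sqint :: "'a measure \<Rightarrow> ('a \<Rightarrow> 'b::euclidean_space) \<Rightarrow> bool" where
  "sqint M f \<longleftrightarrow> f \<in> borel_measurable M \<and> integrable M (\<lambda>x. (norm (f x))\<^sup>2)"

text \<open>Convergence in \<open>H01\<close> is phrased with extended nonnegative integrals, inner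
  products with Bochner integrals; this is the bridge between the two.\<close>

lemma sqint_iff_nn_integral:
  "sqint M f \<longleftrightarrow> f \<in> borel_measurable M \<and> (\<integral>\<^sup>+x. ennreal ((norm (f x))\<^sup>2) \<partial>M) < \<infinity>"
  unfolding sqint_def by (auto simp: integrable_iff_bounded)

lemma sqint_measurable [measurable_dest]: "sqint M f \<Longrightarrow> f \<in> borel_measurable M"
  by (simp add: sqint_def)

lemma norm_add_sq_le:
  fixes a b :: "'b::real_inner"
  shows "(norm (a + b))\<^sup>2 \<le> 2 * (norm a)\<^sup>2 + 2 * (norm b)\<^sup>2"
proof -
  have "(norm (a + b))\<^sup>2 \<le> (norm a + norm b)\<^sup>2"
    by (intro power_mono norm_triangle_ineq) auto
  also have "\<dots> \<le> 2 * (norm a)\<^sup>2 + 2 * (norm b)\<^sup>2"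
    using sum_squares_bound[of "norm a" "norm b"] by (simp add: power2_sum)
  finally show ?thesis .
qed

lemma sqint_bound:
  assumes "sqint M f" "g \<in> borel_measurable M" "\<And>x. norm (g x) \<le> C * norm (f x)"
  shows "sqint M g"
proof -
  have "integrable M (\<lambda>x. (norm (g x))\<^sup>2)"
  proof (rule Bochner_Integration.integrable_bound)
    show "integrable M (\<lambda>x. C\<^sup>2 * (norm (f x))\<^sup>2)"
      using assms(1) by (simp add: sqint_def)
    show "AE x in M. norm ((norm (g x))\<^sup>2) \<le> norm (C\<^sup>2 * (norm (f x))\<^sup>2)"
      using assms(3) power_mono[OF assms(3), of _ 2] by (simp add: power_mult_distrib)
  qed (use assms in measurable)
  then show ?thesis using assms by (simp add: sqint_def)
qed

lemma sqint_add:
  assumes "sqint M f" "sqint M g"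
  shows "sqint M (\<lambda>x. f x + g x)"
proof -
  have "integrable M (\<lambda>x. (norm (f x + g x))\<^sup>2)"
  proof (rule Bochner_Integration.integrable_bound)
    show "integrable M (\<lambda>x. 2 * (norm (f x))\<^sup>2 + 2 * (norm (g x))\<^sup>2)"
      using assms by (simp add: sqint_def)
    show "AE x in M. norm ((norm (f x + g x))\<^sup>2) \<le> norm (2 * (norm (f x))\<^sup>2 + 2 * (norm (g x))\<^sup>2)"
      using norm_add_sq_le[of "f _" "g _"] by simp
  qed (use assms in measurable)
  then show ?thesis using assms by (auto simp: sqint_def)
qed

lemma sqint_diff:
  assumes "sqint M f" "sqint M g"
  shows "sqint M (\<lambda>x. f x - g x)"
proof -
  have "sqint M (\<lambda>x. - g x)"
    by (rule sqint_bound[OF assms(2), where C = 1]) (use assms in \<open>auto simp: sqint_def\<close>)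
  from sqint_add[OF assms(1) this] show ?thesis by simp
qed

lemma sqint_inner:
  assumes "sqint M f" "sqint M g"
  shows "integrable M (\<lambda>x. f x \<bullet> g x)"
proof (rule Bochner_Integration.integrable_bound)
  show "integrable M (\<lambda>x. (norm (f x))\<^sup>2 + (norm (g x))\<^sup>2)"
    using assms by (simp add: sqint_def)
  have "\<bar>a \<bullet> b\<bar> \<le> (norm a)\<^sup>2 + (norm b)\<^sup>2" for a b :: 'b
  proof -
    have "0 \<le> norm a * norm b" by simp
    then show ?thesis
      using Cauchy_Schwarz_ineq2[of a b] sum_squares_bound[of "norm a" "norm b"] by linarith
  qed
  then show "AE x in M. norm (f x \<bullet> g x) \<le> norm ((norm (f x))\<^sup>2 + (norm (g x))\<^sup>2)"
    by simp
qed (use assms in measurable)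

text \<open>The pointwise inequality reduces vector-valued functions to their norms, where the
  version for nonnegative extended integrals applies.\<close>

lemma sqint_Cauchy_Schwarz:
  assumes "sqint M f" "sqint M g"
  shows "(\<integral>x. f x \<bullet> g x \<partial>M)\<^sup>2 \<le> (\<integral>x. (norm (f x))\<^sup>2 \<partial>M) * (\<integral>x. (norm (g x))\<^sup>2 \<partial>M)"
proof -
  have [measurable]: "f \<in> borel_measurable M" "g \<in> borel_measurable M"
    using assms by (simp_all add: sqint_def)
  have i: "integrable M (\<lambda>x. norm (f x) * norm (g x))"
    using sqint_inner[of M "\<lambda>x. norm (f x)" "\<lambda>x. norm (g x)"] assms by (simp add: sqint_def)
  have "\<bar>\<integral>x. f x \<bullet> g x \<partial>M\<bar> \<le> (\<integral>x. norm (f x) * norm (g x) \<partial>M)"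
    using i by (intro integral_abs_bound[THEN order_trans] integral_mono)
      (auto intro: integrable_abs sqint_inner[OF assms] Cauchy_Schwarz_ineq2)
  then have 1: "(\<integral>x. f x \<bullet> g x \<partial>M)\<^sup>2 \<le> (\<integral>x. norm (f x) * norm (g x) \<partial>M)\<^sup>2"
    by (metis abs_ge_zero power2_abs power_mono)
  have "(\<integral>\<^sup>+x. ennreal (norm (f x)) * ennreal (norm (g x)) \<partial>M)\<^sup>2 \<le>
    (\<integral>\<^sup>+x. (ennreal (norm (f x)))\<^sup>2 \<partial>M) * (\<integral>\<^sup>+x. (ennreal (norm (g x)))\<^sup>2 \<partial>M)"
    by (intro Cauchy_Schwarz_nn_integral) measurable
  also have "(\<integral>\<^sup>+x. ennreal (norm (f x)) * ennreal (norm (g x)) \<partial>M) = ennreal (\<integral>x. norm (f x) * norm (g x) \<partial>M)"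
    using i by (subst nn_integral_eq_integral[symmetric]) (auto simp: ennreal_mult)
  also have "(\<integral>\<^sup>+x. (ennreal (norm (f x)))\<^sup>2 \<partial>M) = ennreal (\<integral>x. (norm (f x))\<^sup>2 \<partial>M)"
    using assms by (subst nn_integral_eq_integral[symmetric]) (auto simp: ennreal_power sqint_def)
  also have "(\<integral>\<^sup>+x. (ennreal (norm (g x)))\<^sup>2 \<partial>M) = ennreal (\<integral>x. (norm (g x))\<^sup>2 \<partial>M)"
    using assms by (subst nn_integral_eq_integral[symmetric]) (auto simp: ennreal_power sqint_def)
  finally have "(\<integral>x. norm (f x) * norm (g x) \<partial>M)\<^sup>2 \<le> (\<integral>x. (norm (f x))\<^sup>2 \<partial>M) * (\<integral>x. (norm (g x))\<^sup>2 \<partial>M)"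
    by (simp add: ennreal_power ennreal_mult[symmetric] integral_nonneg_AE ennreal_le_iff)
  with 1 show ?thesis by linarith
qed

text \<open>A sequence of extended integrals tending to 0 is eventually finite, so \<open>h\<close>
  differs from some \<open>g k\<close> by a square-integrable function.\<close>

lemma sqint_limit:
  assumes g: "\<And>k. sqint M (g k)" and h: "h \<in> borel_measurable M"
    and lim: "(\<lambda>k. \<integral>\<^sup>+x. ennreal ((norm (g k x - h x))\<^sup>2) \<partial>M) \<longlonglongrightarrow> 0"
  shows "sqint M h"
proof -
  have "eventually (\<lambda>k. (\<integral>\<^sup>+x. ennreal ((norm (g k x - h x))\<^sup>2) \<partial>M) < \<infinity>) sequentially"
    using order_tendstoD(2)[OF lim, of \<infinity>] by simp
  then obtain k where "(\<integral>\<^sup>+x. ennreal ((norm (g k x - h x))\<^sup>2) \<partial>M) < \<infinity>"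
    by (auto simp: eventually_sequentially)
  then have "sqint M (\<lambda>x. g k x - h x)"
    using g[of k] h by (auto simp: sqint_iff_nn_integral)
  from sqint_diff[OF g[of k] this] show ?thesis by simp
qed

text \<open>Cauchy-Schwarz bounds the squared error by a multiple of the L^2 distance. Only
  measurability of \<open>h\<close> is asked for, so the data supplied by \<open>H01\<close> can be
  used directly.\<close>

lemma sqint_inner_limit:
  assumes f: "sqint M f" and g: "\<And>k. sqint M (g k)" and h: "h \<in> borel_measurable M"
    and lim: "(\<lambda>k. \<integral>\<^sup>+x. ennreal ((norm (g k x - h x))\<^sup>2) \<partial>M) \<longlonglongrightarrow> 0"
  shows "(\<lambda>k. \<integral>x. f x \<bullet> g k x \<partial>M) \<longlonglongrightarrow> (\<integral>x. f x \<bullet> h x \<partial>M)"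
proof -
  have h': "sqint M h" by (rule sqint_limit[OF g h lim])
  have d: "sqint M (\<lambda>x. g k x - h x)" for k by (rule sqint_diff[OF g h'])
  have "(\<integral>\<^sup>+x. ennreal ((norm (g k x - h x))\<^sup>2) \<partial>M) = ennreal (\<integral>x. (norm (g k x - h x))\<^sup>2 \<partial>M)" for k
    using d[of k] by (subst nn_integral_eq_integral) (auto simp: sqint_def)
  with lim have l: "(\<lambda>k. \<integral>x. (norm (g k x - h x))\<^sup>2 \<partial>M) \<longlonglongrightarrow> 0"
    by (simp add: ennreal_0[symmetric] del: ennreal_0)
  have eq: "(\<integral>x. f x \<bullet> (g k x - h x) \<partial>M) = (\<integral>x. f x \<bullet> g k x \<partial>M) - (\<integral>x. f x \<bullet> h x \<partial>M)" for k
    using sqint_inner[OF f g] sqint_inner[OF f h'] by (simp add: inner_diff_right)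
  have "(\<lambda>k. (\<integral>x. f x \<bullet> (g k x - h x) \<partial>M)\<^sup>2) \<longlonglongrightarrow> 0"
  proof (rule tendsto_sandwich[where f = "\<lambda>_. 0"])
    show "\<forall>\<^sub>F k in sequentially. (\<integral>x. f x \<bullet> (g k x - h x) \<partial>M)\<^sup>2 \<le>
       (\<integral>x. (norm (f x))\<^sup>2 \<partial>M) * (\<integral>x. (norm (g k x - h x))\<^sup>2 \<partial>M)"
      using sqint_Cauchy_Schwarz[OF f d] by simp
    show "(\<lambda>k. (\<integral>x. (norm (f x))\<^sup>2 \<partial>M) * (\<integral>x. (norm (g k x - h x))\<^sup>2 \<partial>M)) \<longlonglongrightarrow> 0"
      using tendsto_mult_left[OF l] by simp
    show "(\<lambda>_. 0::real) \<longlonglongrightarrow> 0" by simp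
  qed simp
  then have "(\<lambda>k. (\<integral>x. f x \<bullet> g k x \<partial>M) - (\<integral>x. f x \<bullet> h x \<partial>M)) \<longlonglongrightarrow> 0"
    by (simp add: eq)
  then show ?thesis by (simp add: LIM_zero_iff)
qed

section \<open>Completeness of the square-integrable functions\<close>

lemma convergent_if_weighted_square_summable:
  fixes y :: "nat \<Rightarrow> 'b::banach"
  assumes "summable (\<lambda>k. 4^k * (norm (y (Suc k) - y k))\<^sup>2)"
  shows "convergent y"
proof -
  have "(\<lambda>k. 4^k * (norm (y (Suc k) - y k))\<^sup>2) \<longlonglongrightarrow> 0"
    by (rule summable_LIMSEQ_zero[OF assms])
  from order_tendstoD(2)[OF this, of 1]
  obtain N where N: "\<And>k. k \<ge> N \<Longrightarrow> 4^k * (norm (y (Suc k) - y k))\<^sup>2 < 1"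
    by (auto simp: eventually_sequentially)
  have "norm (y (Suc k) - y k) \<le> (1/2)^k" if "k \<ge> N" for k
  proof -
    have "(2^k * norm (y (Suc k) - y k))\<^sup>2 < 1\<^sup>2"
      using N[OF that] by (simp add: power_mult_distrib power2_eq_square[of "2^k"] flip: power_mult_distrib[of 2 2])
    then have "2^k * norm (y (Suc k) - y k) < 1"
      by (rule power_less_imp_less_base) simp
    then show ?thesis by (simp add: power_one_over field_simps)
  qed
  then have "summable (\<lambda>k. y (Suc k) - y k)"
    by (intro summable_comparison_test[OF _ summable_geometric[of "1/2::real"]]) auto
  then have "convergent (\<lambda>n. \<Sum>k<n. y (Suc k) - y k)"
    by (simp add: summable_iff_convergent)
  then have "convergent (\<lambda>n. y n - y 0)" by (simp add: sum_lessThan_telescope)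
  then have "convergent (\<lambda>n. (y n - y 0) + y 0)" by (intro convergent_add convergent_const)
  then show ?thesis by simp
qed

text \<open>A fast subsequence converges almost everywhere because a weighted sum of its squared
  increments has finite integral. Fatou then transfers the Cauchy estimate of the whole sequence to
  the limit. Weighted squares keep the argument free of a triangle inequality for the L^2
  norm.\<close>

lemma Riesz_Fischer_sq:
  fixes f :: "nat \<Rightarrow> 'a \<Rightarrow> 'b::euclidean_space"
  assumes [measurable]: "\<And>k. f k \<in> borel_measurable M"
    and Cauchy: "\<And>e::real. e > 0 \<Longrightarrow> \<exists>N. \<forall>k\<ge>N. \<forall>l\<ge>N.
        (\<integral>\<^sup>+x. ennreal ((norm (f k x - f l x))\<^sup>2) \<partial>M) \<le> ennreal e"
  obtains g where "g \<in> borel_measurable M"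
    "(\<lambda>k. \<integral>\<^sup>+x. ennreal ((norm (f k x - g x))\<^sup>2) \<partial>M) \<longlonglongrightarrow> 0"
proof -
  have "\<forall>j. \<exists>N. \<forall>k\<ge>N. \<forall>l\<ge>N. (\<integral>\<^sup>+x. ennreal ((norm (f k x - f l x))\<^sup>2) \<partial>M) \<le> ennreal ((1/8)^j)"
    using Cauchy by simp
  then obtain N where N: "\<And>j k l. k \<ge> N j \<Longrightarrow> l \<ge> N j \<Longrightarrow>
      (\<integral>\<^sup>+x. ennreal ((norm (f k x - f l x))\<^sup>2) \<partial>M) \<le> ennreal ((1/8)^j)"
    by metis
  \<comment> \<open>Summing the thresholds makes \<open>r\<close> monotone and at least
    \<open>N j\<close>; the extra \<open>j\<close> makes it unbounded.\<close>
  define r where "r j = (\<Sum>i\<le>j. N i) + j" for j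
  have rN: "r j \<ge> N j" for j unfolding r_def by (simp add: atMost_Suc sum.remove[of "{..j}" j] trans_le_add1)
  have r1: "r (Suc j) \<ge> r j" for j unfolding r_def by simp
  have rj: "r j \<ge> j" for j unfolding r_def by simp
  \<comment> \<open>Weight 4^j against tolerance 8^(-j) leaves the summable 2^(-j), and finiteness
    of the sum forces the increments below 2^(-j) eventually.\<close>
  define S where "S x = (\<Sum>j. ennreal (4^j * (norm (f (r (Suc j)) x - f (r j) x))\<^sup>2))" for x
  have "(\<integral>\<^sup>+x. S x \<partial>M) = (\<Sum>j. \<integral>\<^sup>+x. ennreal (4^j * (norm (f (r (Suc j)) x - f (r j) x))\<^sup>2) \<partial>M)"
    unfolding S_def by (intro nn_integral_suminf) measurable
  also have "\<dots> \<le> (\<Sum>j. ennreal ((1/2)^j))"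
  proof (intro suminf_le)
    fix j
    have "(\<integral>\<^sup>+x. ennreal (4^j * (norm (f (r (Suc j)) x - f (r j) x))\<^sup>2) \<partial>M)
        = ennreal (4^j) * (\<integral>\<^sup>+x. ennreal ((norm (f (r (Suc j)) x - f (r j) x))\<^sup>2) \<partial>M)"
      by (subst nn_integral_cmult[symmetric]) (auto simp: ennreal_mult)
    also have "\<dots> \<le> ennreal (4^j) * ennreal ((1/8)^j)"
      using rN[of j] r1[of j] by (intro mult_left_mono N) auto
    also have "\<dots> = ennreal ((1/2)^j)"
      by (simp add: ennreal_mult[symmetric] flip: power_mult_distrib)
    finally show "(\<integral>\<^sup>+x. ennreal (4^j * (norm (f (r (Suc j)) x - f (r j) x))\<^sup>2) \<partial>M) \<le> ennreal ((1/2)^j)" .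
  qed auto
  also have "\<dots> = ennreal (\<Sum>j. (1/2)^j)"
    by (intro suminf_ennreal2) (auto intro: summable_geometric)
  finally have "(\<integral>\<^sup>+x. S x \<partial>M) < \<infinity>"
    by (auto simp: top_unique less_top[symmetric])
  moreover have [measurable]: "S \<in> borel_measurable M" unfolding S_def by measurable
  ultimately have fin: "AE x in M. S x \<noteq> \<infinity>"
    by (intro nn_integral_PInf_AE) auto
  have conv: "AE x in M. convergent (\<lambda>j. f (r j) x)"
    using fin
  proof eventually_elim
    case (elim x)
    have "summable (\<lambda>j. 4^j * (norm (f (r (Suc j)) x - f (r j) x))\<^sup>2)"
      using elim unfolding S_def by (intro summable_suminf_not_top) auto
    then show ?case by (rule convergent_if_weighted_square_summable)
  qed
  define g where "g x = lim (\<lambda>j. f (r j) x)" for x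
  have [measurable]: "g \<in> borel_measurable M" unfolding g_def by measurable
  have lim: "AE x in M. (\<lambda>j. f (r j) x) \<longlonglongrightarrow> g x"
    using conv by eventually_elim (simp add: g_def convergent_LIMSEQ_iff)
  \<comment> \<open>Fatou along \<open>r\<close>: a Cauchy bound with the first index fixed passes
    to the limit in the second.\<close>
  have bd: "(\<integral>\<^sup>+x. ennreal ((norm (f k x - g x))\<^sup>2) \<partial>M) \<le> ennreal e"
    if e: "\<And>l. l \<ge> L \<Longrightarrow> (\<integral>\<^sup>+x. ennreal ((norm (f k x - f l x))\<^sup>2) \<partial>M) \<le> ennreal e" for k e L
  proof -
    have "(\<integral>\<^sup>+x. ennreal ((norm (f k x - g x))\<^sup>2) \<partial>M)
        = (\<integral>\<^sup>+x. liminf (\<lambda>j. ennreal ((norm (f k x - f (r j) x))\<^sup>2)) \<partial>M)"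
    proof (rule nn_integral_cong_AE)
      show "AE x in M. ennreal ((norm (f k x - g x))\<^sup>2) = liminf (\<lambda>j. ennreal ((norm (f k x - f (r j) x))\<^sup>2))"
        using lim
      proof eventually_elim
        case (elim x)
        show ?case
          by (intro lim_imp_Liminf[symmetric] tendsto_ennrealI tendsto_intros elim) simp
      qed
    qed
    also have "\<dots> \<le> liminf (\<lambda>j. \<integral>\<^sup>+x. ennreal ((norm (f k x - f (r j) x))\<^sup>2) \<partial>M)"
      by (intro nn_integral_liminf) measurable
    also have "\<dots> \<le> liminf (\<lambda>j. ennreal e)"
    proof (rule Liminf_mono)
      show "\<forall>\<^sub>F j in sequentially. (\<integral>\<^sup>+x. ennreal ((norm (f k x - f (r j) x))\<^sup>2) \<partial>M) \<le> ennreal e"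
        unfolding eventually_sequentially using e rj by (meson order_trans)
    qed
    also have "\<dots> = ennreal e" by (simp add: Liminf_const)
    finally show ?thesis .
  qed
  have "(\<lambda>k. \<integral>\<^sup>+x. ennreal ((norm (f k x - g x))\<^sup>2) \<partial>M) \<longlonglongrightarrow> 0"
  proof (rule order_tendstoI)
    fix a :: ennreal assume "0 < a"
    then obtain e where e: "0 < e" "e < a" using dense by blast
    define e' where "e' = enn2real e"
    have "e < \<infinity>" using e(2) by (metis infinity_ennreal_def less_top_ennreal order_less_trans not_less_iff_gr_or_eq top.not_eq_extremum)
    then have e': "e = ennreal e'" "e' > 0" using e(1) unfolding e'_def
      by (auto simp: enn2real_positive_iff)
    obtain L where "\<forall>k\<ge>L. \<forall>l\<ge>L. (\<integral>\<^sup>+x. ennreal ((norm (f k x - f l x))\<^sup>2) \<partial>M) \<le> ennreal e'"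
      using Cauchy[OF e'(2)] by blast
    then have "\<forall>k\<ge>L. (\<integral>\<^sup>+x. ennreal ((norm (f k x - g x))\<^sup>2) \<partial>M) \<le> ennreal e'"
      using bd by blast
    then show "\<forall>\<^sub>F k in sequentially. (\<integral>\<^sup>+x. ennreal ((norm (f k x - g x))\<^sup>2) \<partial>M) < a"
      unfolding eventually_sequentially using e(2) e'(1) by (meson order_le_less_trans)
  qed simp
  then show thesis using that[of g] by simp
qed

section \<open>Smooth functions and test functions\<close>

lemma partial_deriv_eq:
  assumes "(f has_derivative D) (at x)"
  shows "partial_deriv f i x = D (axis i 1)"
  using frechet_derivative_at[OF assms] by (simp add: partial_deriv_def)

lemma partial_deriv_add:
  assumes "f differentiable at x" "g differentiable at x"
  shows "partial_deriv (\<lambda>x. f x + g x) i x = partial_deriv f i x + partial_deriv g i x"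
  using partial_deriv_eq[OF has_derivative_add[OF assms[unfolded frechet_derivative_works]]]
  by (simp add: partial_deriv_def)

lemma partial_deriv_mult:
  assumes "f differentiable at x" "g differentiable at x"
  shows "partial_deriv (\<lambda>x. f x * g x) i x = f x * partial_deriv g i x + partial_deriv f i x * g x"
  using partial_deriv_eq[OF has_derivative_mult[OF assms[unfolded frechet_derivative_works]]]
  by (simp add: partial_deriv_def)

lemma has_derivative_comp_real:
  assumes "f differentiable at x" "DERIV g (f x) :> d"
  shows "((\<lambda>x. g (f x)) has_derivative (\<lambda>h. d * frechet_derivative f (at x) h)) (at x)"
  using has_derivative_compose[OF assms(1)[unfolded frechet_derivative_works] assms(2)[unfolded has_field_derivative_def]]
  by simp

lemma Ck_const: "Ck k (\<lambda>x. c)"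
proof (induction k arbitrary: c)
  case (Suc k)
  have "partial_deriv (\<lambda>x. c) i = (\<lambda>x. 0)" for i :: 'a
    by (auto simp: partial_deriv_def)
  with Suc show ?case by simp
qed simp

lemma Ck_Suc_imp_Ck: "Ck (Suc k) f \<Longrightarrow> Ck k f"
proof (induction k arbitrary: f)
  case 0
  then show ?case
    by (auto intro!: differentiable_imp_continuous_on simp: differentiable_on_def differentiable_at_withinI)
qed auto

lemma Ck_add: "Ck k f \<Longrightarrow> Ck k g \<Longrightarrow> Ck k (\<lambda>x. f x + g x)"
proof (induction k arbitrary: f g)
  case (Suc k)
  have "partial_deriv (\<lambda>x. f x + g x) i = (\<lambda>x. partial_deriv f i x + partial_deriv g i x)" for i
    using Suc.prems by (auto simp: partial_deriv_add)
  with Suc show ?case by simp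
qed (simp add: continuous_on_add)

text \<open>The product rule also multiplies derivatives by the undifferentiated factors, so the
  induction uses that \<open>Ck (Suc k)\<close> implies \<open>Ck k\<close>.\<close>

lemma Ck_mult: "Ck k f \<Longrightarrow> Ck k g \<Longrightarrow> Ck k (\<lambda>x. f x * g x)"
proof (induction k arbitrary: f g)
  case (Suc k)
  have "partial_deriv (\<lambda>x. f x * g x) i = (\<lambda>x. f x * partial_deriv g i x + partial_deriv f i x * g x)" for i
    using Suc.prems by (auto simp: partial_deriv_mult)
  moreover have "Ck k (\<lambda>x. f x * partial_deriv g i x + partial_deriv f i x * g x)" for i
    using Suc.prems Ck_Suc_imp_Ck[OF Suc.prems(1)] Ck_Suc_imp_Ck[OF Suc.prems(2)]
    by (intro Ck_add Suc.IH) simp_all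
  ultimately show ?case using Suc.prems by simp
qed (simp add: continuous_on_mult)

section \<open>Smooth functions of one real variable and composition\<close>

text \<open>\<open>Ck\<close> concerns functions on \<open>real^'m\<close>, whereas outer functions
  of a composition live on \<open>real\<close>. \<open>DERIV\<close> determines \<open>f'\<close>
  uniquely, so the existential costs nothing and lets each proof supply an explicit
  derivative.\<close>

fun Ck_real :: "nat \<Rightarrow> (real \<Rightarrow> real) \<Rightarrow> bool" where
  "Ck_real 0 f = continuous_on UNIV f"
| "Ck_real (Suc k) f = (\<exists>f'. (\<forall>x. DERIV f x :> f' x) \<and> Ck_real k f')"

definition smooth_real :: "(real \<Rightarrow> real) \<Rightarrow> bool" where
  "smooth_real f = (\<forall>k. Ck_real k f)"

lemma Ck_real_const: "Ck_real k (\<lambda>x. c)"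
proof (induction k arbitrary: c)
  case (Suc k)
  show ?case
    using Suc[of 0] by (auto intro!: exI[of _ "\<lambda>x. 0"])
qed simp

lemma Ck_real_ident: "Ck_real k (\<lambda>x. x)"
  by (cases k) (auto intro!: exI[of _ "\<lambda>x. 1"] Ck_real_const)

lemma Ck_real_Suc_imp: "Ck_real (Suc k) f \<Longrightarrow> Ck_real k f"
proof (induction k arbitrary: f)
  case 0
  then obtain f' where "\<And>x. DERIV f x :> f' x" by auto
  then show ?case by (auto intro: DERIV_isCont continuous_at_imp_continuous_on)
qed auto

lemma Ck_real_add: "Ck_real k f \<Longrightarrow> Ck_real k g \<Longrightarrow> Ck_real k (\<lambda>x. f x + g x)"
proof (induction k arbitrary: f g)
  case (Suc k)
  then obtain f' g' where "\<And>x. DERIV f x :> f' x" "Ck_real k f'" "\<And>x. DERIV g x :> g' x" "Ck_real k g'"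
    by auto
  with Suc.IH show ?case
    by (auto intro!: exI[of _ "\<lambda>x. f' x + g' x"] DERIV_add)
qed (simp add: continuous_on_add)

lemma Ck_real_mult: "Ck_real k f \<Longrightarrow> Ck_real k g \<Longrightarrow> Ck_real k (\<lambda>x. f x * g x)"
proof (induction k arbitrary: f g)
  case (Suc k)
  then obtain f' g' where *: "\<And>x. DERIV f x :> f' x" "Ck_real k f'" "\<And>x. DERIV g x :> g' x" "Ck_real k g'"
    by auto
  have "Ck_real k (\<lambda>x. f' x * g x + g' x * f x)"
    using * Ck_real_Suc_imp[OF Suc.prems(1)] Ck_real_Suc_imp[OF Suc.prems(2)]
    by (intro Ck_real_add Suc.IH)
  with * show ?case
    by (auto intro!: exI[of _ "\<lambda>x. f' x * g x + g' x * f x"] DERIV_mult)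
qed (simp add: continuous_on_mult)

text \<open>Differentiation lowers the exponent and adds a linear factor, so the family over all
  exponents is closed under it; hence the induction with \<open>a\<close> arbitrary. The base stays
  positive, so \<open>powr\<close> is never differentiated at 0. Both factors of the later weight
  have this shape.\<close>

lemma Ck_real_quadratic_powr:
  assumes "c > 0" "b \<ge> 0"
  shows "Ck_real k (\<lambda>t. (c + b * t\<^sup>2) powr a)"
proof (induction k arbitrary: a)
  case 0
  have "c + b * t\<^sup>2 > 0" for t using assms by (simp add: add_pos_nonneg)
  then show ?case by (auto intro!: continuous_intros simp: less_imp_neq[symmetric])
next
  case (Suc k)
  have p: "c + b * t\<^sup>2 > 0" for t using assms by (simp add: add_pos_nonneg)
  have "DERIV (\<lambda>t. (c + b * t\<^sup>2) powr a) t :> (a * (c + b * t\<^sup>2) powr (a - 1)) * (2 * b * t)" for t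
    using p[of t] by (auto intro!: derivative_eq_intros simp: algebra_simps powr_diff)
  moreover have "Ck_real k (\<lambda>t. (a * (c + b * t\<^sup>2) powr (a - 1)) * (2 * b * t))"
    by (intro Ck_real_mult Suc.IH Ck_real_const Ck_real_ident)
  ultimately show ?case
    by (auto intro!: exI[of _ "\<lambda>t. (a * (c + b * t\<^sup>2) powr (a - 1)) * (2 * b * t)"])
qed

lemma smooth_real_mult: "smooth_real f \<Longrightarrow> smooth_real g \<Longrightarrow> smooth_real (\<lambda>x. f x * g x)"
  by (simp add: smooth_real_def Ck_real_mult)

lemma smooth_real_continuous: "smooth_real f \<Longrightarrow> continuous_on UNIV f"
  unfolding smooth_real_def by (metis Ck_real.simps(1))

lemma smooth_real_antiderivative:
  assumes "smooth_real f'" "\<And>x. DERIV f x :> f' x"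
  shows "smooth_real f"
  unfolding smooth_real_def
proof
  fix k
  have "Ck_real (Suc k) f" using assms by (auto simp: smooth_real_def)
  then show "Ck_real k f" by (rule Ck_real_Suc_imp)
qed

lemma Ck_comp: "Ck_real k g \<Longrightarrow> Ck k f \<Longrightarrow> Ck k (\<lambda>x. g (f x))"
proof (induction k arbitrary: f g)
  case 0
  then show ?case by (auto intro: continuous_on_compose2)
next
  case (Suc k)
  then obtain g' where g': "\<And>x. DERIV g x :> g' x" "Ck_real k g'" by auto
  have f: "f differentiable at x" for x using Suc.prems by simp
  note d = has_derivative_comp_real[OF f g'(1)]
  have "partial_deriv (\<lambda>x. g (f x)) i = (\<lambda>x. g' (f x) * partial_deriv f i x)" for i
    using partial_deriv_eq[OF d] by (auto simp: partial_deriv_def)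
  moreover have "Ck k (\<lambda>x. g' (f x) * partial_deriv f i x)" for i
    using Suc.prems by (intro Ck_mult Suc.IH[OF g'(2)] Ck_Suc_imp_Ck[OF Suc.prems(2)]) auto
  moreover have "(\<lambda>x. g (f x)) differentiable at x" for x
    using d unfolding differentiable_def by blast
  ultimately show ?case by simp
qed

lemma grad_comp:
  assumes "f differentiable at x" "DERIV g (f x) :> d"
  shows "grad (\<lambda>x. g (f x)) x = d *\<^sub>R grad f x"
  using partial_deriv_eq[OF has_derivative_comp_real[OF assms]]
  by (simp add: grad_def vec_eq_iff partial_deriv_def)

lemma smooth_fun_differentiable: "smooth_fun f \<Longrightarrow> f differentiable at x"
  unfolding smooth_fun_def by (metis Ck.simps(2))

lemma smooth_fun_continuous: "smooth_fun f \<Longrightarrow> continuous_on UNIV f"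
  unfolding smooth_fun_def by (metis Ck.simps(1))

lemma smooth_fun_continuous_grad: "smooth_fun f \<Longrightarrow> continuous_on UNIV (grad f)"
proof -
  assume "smooth_fun f"
  then have "Ck (Suc 0) f" by (simp only: smooth_fun_def)
  then show ?thesis unfolding grad_def by (intro continuous_on_vec_lambda) simp
qed

section \<open>Supports, gradients and integrability of test functions\<close>

lemma closed_subset_compact: "compact K \<Longrightarrow> closed S \<Longrightarrow> S \<subseteq> K \<Longrightarrow> compact S"
  using compact_Int_closed[of K S] by (simp add: inf.absorb2)

text \<open>The shape \<open>f + c g\<close> covers both differences (\<open>c = -1\<close>) and the
  perturbations of the variational argument.\<close>

lemma test_fun_linear:
  assumes "test_fun \<Omega> f" "test_fun \<Omega> g"
  shows "test_fun \<Omega> (\<lambda>x. f x + c * g x)"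
proof -
  have "{x. f x + c * g x \<noteq> 0} \<subseteq> {x. f x \<noteq> 0} \<union> {x. g x \<noteq> 0}" by auto
  then have sub: "tsupport (\<lambda>x. f x + c * g x) \<subseteq> tsupport f \<union> tsupport g"
    unfolding tsupport_def closure_Un[symmetric] by (rule closure_mono)
  have "compact (tsupport f \<union> tsupport g)" using assms by (auto simp: test_fun_def)
  then have "compact (tsupport (\<lambda>x. f x + c * g x))"
    by (rule closed_subset_compact) (use sub in \<open>auto simp: tsupport_def\<close>)
  then show ?thesis
    using assms sub by (auto simp: test_fun_def smooth_fun_def intro!: Ck_add Ck_mult Ck_const)
qed

text \<open>The condition \<open>g 0 = 0\<close> keeps the support from growing.\<close>

lemma test_fun_comp:
  assumes "test_fun \<Omega> f" "smooth_real g" "g 0 = 0"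
  shows "test_fun \<Omega> (\<lambda>x. g (f x))"
proof -
  have sub: "tsupport (\<lambda>x. g (f x)) \<subseteq> tsupport f"
    unfolding tsupport_def by (rule closure_mono) (use assms(3) in auto)
  have "compact (tsupport f)" using assms(1) by (simp add: test_fun_def)
  then have "compact (tsupport (\<lambda>x. g (f x)))"
    by (rule closed_subset_compact) (use sub in \<open>auto simp: tsupport_def\<close>)
  then show ?thesis
    using assms sub by (auto simp: test_fun_def smooth_fun_def smooth_real_def intro!: Ck_comp[of _ g f])
qed

lemma test_fun_zero: "test_fun \<Omega> (\<lambda>x. 0)"
  by (auto simp: test_fun_def smooth_fun_def Ck_const tsupport_def)

lemma grad_linear:
  assumes "smooth_fun f" "smooth_fun g"
  shows "grad (\<lambda>x. f x + c * g x) x = grad f x + c *\<^sub>R grad g x"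
proof -
  have "(\<lambda>x. c * g x) differentiable at x"
    using smooth_fun_differentiable[OF assms(2)] by (intro derivative_intros) auto
  moreover have "partial_deriv (\<lambda>x. c * g x) i x = c * partial_deriv g i x" for i
    using smooth_fun_differentiable[OF assms(2), of x]
    by (subst partial_deriv_mult) (auto simp: partial_deriv_def)
  ultimately show ?thesis
    using smooth_fun_differentiable[OF assms(1), of x]
    by (auto simp: grad_def vec_eq_iff partial_deriv_add)
qed

text \<open>The support is closed, so \<open>f\<close> vanishes on a whole neighbourhood of
  \<open>x\<close>.\<close>

lemma grad_eq_0_outside_support:
  assumes "x \<notin> tsupport f"
  shows "grad f x = 0"
proof -
  have "open (- tsupport f)" by (simp add: tsupport_def open_Compl)
  moreover have "f y = 0" if "y \<in> - tsupport f" for y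
    using that closure_subset[of "{x. f x \<noteq> 0}"] by (auto simp: tsupport_def)
  ultimately have "(f has_derivative (\<lambda>h. 0)) (at x)"
    using assms by (intro has_derivative_transform_within_open[OF has_derivative_const[of 0]]) auto
  from partial_deriv_eq[OF this] show ?thesis by (simp add: grad_def vec_eq_iff)
qed

lemma continuous_compact_support_sqint:
  fixes f :: "real^'m \<Rightarrow> 'b::euclidean_space"
  assumes "continuous_on UNIV f" "compact K" "\<And>x. x \<notin> K \<Longrightarrow> f x = 0"
  shows "sqint lebesgue f"
proof -
  have "integrable lborel (\<lambda>x. indicator K x *\<^sub>R (norm (f x))\<^sup>2)"
    using assms by (intro borel_integrable_compact continuous_intros continuous_on_subset[OF assms(1)]) auto
  moreover have "(\<lambda>x. indicator K x *\<^sub>R (norm (f x))\<^sup>2) = (\<lambda>x. (norm (f x))\<^sup>2)"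
    using assms(3) by (auto simp: indicator_def fun_eq_iff)
  moreover have "f \<in> borel_measurable borel"
    by (rule borel_measurable_continuous_onI[OF assms(1)])
  ultimately show ?thesis
    unfolding sqint_def by (simp add: integrable_completion borel_measurable_continuous_onI measurable_completion)
qed

lemma test_fun_sqint:
  assumes "test_fun \<Omega> f"
  shows "sqint lebesgue f" "sqint lebesgue (grad f)"
proof -
  have "f x = 0" if "x \<notin> tsupport f" for x
    using that closure_subset[of "{x. f x \<noteq> 0}"] by (auto simp: tsupport_def)
  then show "sqint lebesgue f" "sqint lebesgue (grad f)"
    using assms grad_eq_0_outside_support
    by (auto simp: test_fun_def smooth_fun_continuous smooth_fun_continuous_grad
        intro!: continuous_compact_support_sqint[of _ "tsupport f"])
qed

lemma test_fun_eq_0_outside: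
  assumes "test_fun \<Omega> f" "x \<notin> \<Omega>"
  shows "f x = 0" "grad f x = 0"
proof -
  have "x \<notin> tsupport f" using assms by (auto simp: test_fun_def)
  then show "f x = 0" "grad f x = 0"
    using closure_subset[of "{x. f x \<noteq> 0}"] grad_eq_0_outside_support by (auto simp: tsupport_def)
qed

lemma test_fun_H01:
  assumes "test_fun \<Omega> f"
  shows "H01 \<Omega> f (grad f)"
  unfolding H01_def using assms test_fun_sqint[OF assms]
  by (auto simp: sqint_def intro!: exI[of _ "\<lambda>k. f"])

lemma H01_sqint:
  assumes "H01 \<Omega> \<phi> G"
  shows "sqint lebesgue \<phi>" "sqint lebesgue G"
proof -
  obtain \<psi> where \<psi>: "\<And>k. test_fun \<Omega> (\<psi> k)"
    "(\<lambda>k. \<integral>\<^sup>+ x. ennreal ((\<psi> k x - \<phi> x)\<^sup>2) \<partial>lebesgue) \<longlonglongrightarrow> 0"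
    "(\<lambda>k. \<integral>\<^sup>+ x. ennreal ((norm (grad (\<psi> k) x - G x))\<^sup>2) \<partial>lebesgue) \<longlonglongrightarrow> 0"
    "\<phi> \<in> borel_measurable lebesgue" "G \<in> borel_measurable lebesgue"
    using assms unfolding H01_def by blast
  show "sqint lebesgue \<phi>"
    using \<psi>(2) by (intro sqint_limit[OF test_fun_sqint(1)[OF \<psi>(1)] \<psi>(4)]) simp
  show "sqint lebesgue G"
    using \<psi>(3) by (intro sqint_limit[OF test_fun_sqint(2)[OF \<psi>(1)] \<psi>(5)])
qed

section \<open>Existence of the torsion function\<close>

text \<open>The direct method for \<open>J f = a f f / 2 - L f\<close>. The space \<open>V\<close>
  is not complete in the energy, so no minimiser is claimed: near-minimality yields the Cauchy
  property and, asymptotically, the Euler-Lagrange equation. Limits are taken later in L^2.\<close>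

lemma quadratic_functional_minimizing_sequence:
  fixes V :: "('a \<Rightarrow> real) set" and a :: "('a \<Rightarrow> real) \<Rightarrow> ('a \<Rightarrow> real) \<Rightarrow> real"
  assumes ne: "V \<noteq> {}"
    and lin: "\<And>f g c. f \<in> V \<Longrightarrow> g \<in> V \<Longrightarrow> (\<lambda>x. f x + c * g x) \<in> V"
    and a_lin: "\<And>f g h c. f \<in> V \<Longrightarrow> g \<in> V \<Longrightarrow> h \<in> V \<Longrightarrow> a (\<lambda>x. f x + c * g x) h = a f h + c * a g h"
    and a_sym: "\<And>f g. f \<in> V \<Longrightarrow> g \<in> V \<Longrightarrow> a f g = a g f"
    and a_nonneg: "\<And>f. f \<in> V \<Longrightarrow> a f f \<ge> 0"
    and L_lin: "\<And>f g c. f \<in> V \<Longrightarrow> g \<in> V \<Longrightarrow> L (\<lambda>x. f x + c * g x) = L f + c * L g"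
    and L_bd: "\<And>f. f \<in> V \<Longrightarrow> (L f)\<^sup>2 \<le> C * a f f" and C: "C \<ge> 0"
  obtains \<psi> :: "nat \<Rightarrow> 'a \<Rightarrow> real" where "\<And>k. \<psi> k \<in> V"
    "\<And>e::real. e > 0 \<Longrightarrow> \<exists>N. \<forall>k\<ge>N. \<forall>l\<ge>N.
        a (\<lambda>x. \<psi> k x + (-1) * \<psi> l x) (\<lambda>x. \<psi> k x + (-1) * \<psi> l x) \<le> e"
    "\<And>\<eta>. \<eta> \<in> V \<Longrightarrow> (\<lambda>k. a (\<psi> k) \<eta>) \<longlonglongrightarrow> L \<eta>"
proof -
  define J where "J f = a f f / 2 - L f" for f
  have expand: "J (\<lambda>x. f x + c * g x) = J f + c * (a f g - L g) + c\<^sup>2 / 2 * a g g"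
    if "f \<in> V" "g \<in> V" for f g c
  proof -
    have "a (\<lambda>x. f x + c * g x) (\<lambda>x. f x + c * g x) = a f (\<lambda>x. f x + c * g x) + c * a g (\<lambda>x. f x + c * g x)"
      using that lin by (intro a_lin) auto
    also have "a f (\<lambda>x. f x + c * g x) = a f f + c * a f g"
      using that by (simp add: a_sym[OF that(1) lin[OF that]] a_lin a_sym[of g f])
    also have "a g (\<lambda>x. f x + c * g x) = a f g + c * a g g"
      using that by (simp add: a_sym[OF that(2) lin[OF that]] a_lin)
    finally show ?thesis
      using that by (simp add: J_def L_lin field_simps power2_eq_square)
  qed
  \<comment> \<open>From |L f| \<le> sqrt (C a(f,f)) \<le> (C + a(f,f)) / 2, in squared form to
    avoid roots.\<close>
  have below: "J f \<ge> - C / 2" if "f \<in> V" for f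
  proof -
    have "((C + a f f) / 2)\<^sup>2 = C * a f f + ((C - a f f) / 2)\<^sup>2"
      by (simp add: power2_eq_square field_simps)
    then have "(L f)\<^sup>2 \<le> ((C + a f f) / 2)\<^sup>2"
      using L_bd[OF that] zero_le_power2[of "(C - a f f) / 2"] by linarith
    moreover have "0 \<le> (C + a f f) / 2" using a_nonneg[OF that] C by simp
    ultimately have "L f \<le> (C + a f f) / 2" by (rule power2_le_imp_le)
    then show ?thesis by (simp add: J_def field_simps)
  qed
  define m where "m = Inf (J ` V)"
  have bdd: "bdd_below (J ` V)" using below by (auto simp: bdd_below_def)
  have m_le: "m \<le> J f" if "f \<in> V" for f
    unfolding m_def using bdd that by (auto intro: cInf_lower)
  have "\<exists>f\<in>V. J f < m + 1 / real (Suc k)" for k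
    using cInf_lessD[of "J ` V" "m + 1 / real (Suc k)"] ne unfolding m_def[symmetric]
    by (auto simp: m_def[symmetric])
  then obtain \<psi> where \<psi>: "\<And>k. \<psi> k \<in> V" and J\<psi>: "\<And>k. J (\<psi> k) < m + 1 / real (Suc k)"
    by metis
  \<comment> \<open>Convexity at the midpoint \<open>f + d/2\<close>: its value is (J f + J g)/2 -
    a(d,d)/8 and is at least \<open>m\<close>, which gives the factor 4.\<close>
  have pair: "a (\<lambda>x. g x + (-1) * f x) (\<lambda>x. g x + (-1) * f x) \<le> 4 * ((J f - m) + (J g - m))"
    if "f \<in> V" "g \<in> V" for f g
  proof -
    define d where "d = (\<lambda>x. g x + (-1) * f x)"
    have d: "d \<in> V" unfolding d_def by (intro lin that)
    have "(\<lambda>x. f x + 1 * d x) = g" by (auto simp: d_def)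
    then have "J g = J f + (a f d - L d) + a d d / 2"
      using expand[OF that(1) d, of 1] by simp
    moreover have "m \<le> J f + (a f d - L d) / 2 + a d d / 8"
      using m_le[OF lin[OF that(1) d, of "1/2"]] expand[OF that(1) d, of "1/2"]
      by (simp add: power2_eq_square)
    ultimately show ?thesis unfolding d_def[symmetric] by argo
  qed
  show thesis
  proof (rule that[of \<psi>])
    fix e :: real assume "e > 0"
    \<comment> \<open>Two excesses below e/8, multiplied by the 4 of \<open>pair\<close>, add up to
      at most e.\<close>
    then obtain N where N: "1 / real (Suc N) < e / 8"
      using nat_approx_posE[of "e / 8"] by auto
    have s: "J (\<psi> k) - m < e / 8" if "k \<ge> N" for k
    proof -
      have "1 / real (Suc k) \<le> 1 / real (Suc N)" using that by (intro frac_le) auto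
      then have "m + 1 / real (Suc k) < m + e / 8" using N by (intro add_strict_left_mono) (rule order_le_less_trans)
      from order_less_trans[OF J\<psi> this] show ?thesis by linarith
    qed
    have "a (\<lambda>x. \<psi> k x + (-1) * \<psi> l x) (\<lambda>x. \<psi> k x + (-1) * \<psi> l x) \<le> e" if "k \<ge> N" "l \<ge> N" for k l
    proof (rule order_trans[OF pair[OF \<psi>[of l] \<psi>[of k]]])
      show "4 * ((J (\<psi> l) - m) + (J (\<psi> k) - m)) \<le> e"
        using s[OF that(1)] s[OF that(2)] by argo
    qed
    then show "\<exists>N. \<forall>k\<ge>N. \<forall>l\<ge>N. a (\<lambda>x. \<psi> k x + (-1) * \<psi> l x) (\<lambda>x. \<psi> k x + (-1) * \<psi> l x) \<le> e"
      by blast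
  next
    fix \<eta> assume \<eta>: "\<eta> \<in> V"
    define B where "B = a \<eta> \<eta>"
    have B: "B \<ge> 0" unfolding B_def by (rule a_nonneg[OF \<eta>])
    have bound: "(a (\<psi> k) \<eta> - L \<eta>)\<^sup>2 \<le> 2 * (B + 1) * (1 / real (Suc k))" for k
    proof -
      define D where "D = a (\<psi> k) \<eta> - L \<eta>"
      \<comment> \<open>Minimises t D + t^2 (B + 1)/2. Using B + 1 instead of B avoids a division by
        zero when \<open>a \<eta> \<eta> = 0\<close>.\<close>
      define t where "t = - D / (B + 1)"
      have tB: "t * (B + 1) = - D" using B by (simp add: t_def)
      have "- (1 / real (Suc k)) \<le> t * D + t\<^sup>2 / 2 * B"
        using m_le[OF lin[OF \<psi> \<eta>], of k t] expand[OF \<psi> \<eta>, of k t] J\<psi>[of k]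
        unfolding D_def B_def by linarith
      also have "\<dots> \<le> t * D + t\<^sup>2 / 2 * (B + 1)" by (simp add: mult_left_mono)
      also have "t\<^sup>2 / 2 * (B + 1) = t * (t * (B + 1)) / 2" by (simp add: power2_eq_square)
      also have "t * D + t * (t * (B + 1)) / 2 = t * D / 2" unfolding tB by simp
      also have "\<dots> = - (D\<^sup>2 / (2 * (B + 1)))" by (simp add: t_def power2_eq_square field_simps)
      finally have "D\<^sup>2 / (2 * (B + 1)) \<le> 1 / real (Suc k)" by simp
      moreover have "2 * (B + 1) > 0" using B by simp
      ultimately show ?thesis unfolding D_def[symmetric]
        by (metis pos_divide_le_eq mult.commute)
    qed
    have "(\<lambda>k. (a (\<psi> k) \<eta> - L \<eta>)\<^sup>2) \<longlonglongrightarrow> 0"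
    proof (rule tendsto_sandwich[where f = "\<lambda>_. 0"])
      show "(\<lambda>k. 2 * (B + 1) * (1 / real (Suc k))) \<longlonglongrightarrow> 0"
        using tendsto_mult_left[OF LIMSEQ_inverse_real_of_nat, of "2 * (B + 1)"]
        by (simp add: inverse_eq_divide)
    qed (use bound in auto)
    then have "(\<lambda>k. a (\<psi> k) \<eta> - L \<eta>) \<longlonglongrightarrow> 0" by simp
    then show "(\<lambda>k. a (\<psi> k) \<eta>) \<longlonglongrightarrow> L \<eta>" by (simp add: LIM_zero_iff)
  qed (use \<psi> in auto)
qed

text \<open>The Rayleigh bound without division, so that it also makes sense for functions of zero
  norm and separates existence from the value of \<open>lambda1\<close>.\<close>

definition poincare :: "(real^'m) set \<Rightarrow> real \<Rightarrow> bool" where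
  "poincare \<Omega> c \<longleftrightarrow> (\<forall>\<phi> G. H01 \<Omega> \<phi> G \<longrightarrow>
     c * (\<integral>x\<in>\<Omega>. (\<phi> x)\<^sup>2 \<partial>lebesgue) \<le> (\<integral>x\<in>\<Omega>. (norm (G x))\<^sup>2 \<partial>lebesgue))"

lemma set_integral_eq_integral:
  fixes f :: "'a \<Rightarrow> real"
  assumes "\<And>x. x \<notin> A \<Longrightarrow> f x = 0"
  shows "(\<integral>x\<in>A. f x \<partial>M) = (\<integral>x. f x \<partial>M)"
  unfolding set_lebesgue_integral_def
  by (rule Bochner_Integration.integral_cong) (use assms in \<open>auto simp: indicator_def\<close>)

lemma sqint_indicator:
  assumes "A \<in> sets M" "emeasure M A < \<infinity>"
  shows "sqint M (indicat_real A)"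
proof -
  have "(\<lambda>x. (norm (indicat_real A x))\<^sup>2) = indicat_real A" by (auto simp: indicator_def)
  then show ?thesis using assms by (simp add: sqint_def)
qed

lemma sqint_restrict:
  assumes "sqint M f" "A \<in> sets M"
  shows "sqint M (\<lambda>x. indicat_real A x *\<^sub>R f x)"
proof -
  have "(\<lambda>x. indicat_real A x *\<^sub>R f x) \<in> borel_measurable M"
    using assms by (intro borel_measurable_scaleR borel_measurable_indicator) (auto simp: sqint_def)
  then show ?thesis
    by (intro sqint_bound[OF assms(1), where C = 1]) (auto simp: indicator_def)
qed

lemma nn_integral_norm_sq:
  "sqint M f \<Longrightarrow> (\<integral>\<^sup>+x. ennreal ((norm (f x))\<^sup>2) \<partial>M) = ennreal (\<integral>x. (norm (f x))\<^sup>2 \<partial>M)"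
  by (intro nn_integral_eq_integral) (auto simp: sqint_def)

text \<open>The minimizing sequence is Cauchy in energy, and the Poincare inequality makes it Cauchy
  in L^2 as well; completeness then gives \<open>v\<close> and \<open>G\<close> separately. The weak
  equation holds first against test functions and extends to \<open>H01\<close> by density, the
  right side being L^2-continuous because \<Omega> has finite measure.\<close>

lemma torsion_exists:
  fixes \<Omega> :: "(real^'m) set"
  assumes \<Omega>: "\<Omega> \<in> sets lebesgue" "emeasure lebesgue \<Omega> < \<infinity>" and c: "c > 0" "poincare \<Omega> c"
  shows "\<exists>v. is_torsion \<Omega> v"
proof -
  define a where "a f g = (\<integral>x. grad f x \<bullet> grad g x \<partial>lebesgue)" for f g :: "real^'m \<Rightarrow> real"
  \<comment> \<open>Writing the integral over \<Omega> as a pairing with the indicator makes the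
    Cauchy-Schwarz and limit lemmas applicable.\<close>
  define L where "L f = (\<integral>x. indicat_real \<Omega> x \<bullet> f x \<partial>lebesgue)" for f :: "real^'m \<Rightarrow> real"
  have ind: "sqint lebesgue (indicat_real \<Omega>)" by (rule sqint_indicator[OF \<Omega>])
  have aa: "a f f = (\<integral>x. (norm (grad f x))\<^sup>2 \<partial>lebesgue)" for f
    by (simp add: a_def power2_norm_eq_inner)
  have P: "c * (\<integral>x. (norm (f x))\<^sup>2 \<partial>lebesgue) \<le> a f f" if "test_fun \<Omega> f" for f
  proof -
    have "(\<integral>x\<in>\<Omega>. (f x)\<^sup>2 \<partial>lebesgue) = (\<integral>x. (f x)\<^sup>2 \<partial>lebesgue)"
      using test_fun_eq_0_outside[OF that] by (intro set_integral_eq_integral) auto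
    moreover have "(\<integral>x\<in>\<Omega>. (norm (grad f x))\<^sup>2 \<partial>lebesgue) = (\<integral>x. (norm (grad f x))\<^sup>2 \<partial>lebesgue)"
      using test_fun_eq_0_outside[OF that] by (intro set_integral_eq_integral) auto
    ultimately show ?thesis
      using c(2)[unfolded poincare_def, rule_format, OF test_fun_H01[OF that]] by (simp add: aa)
  qed
  have gl: "grad (\<lambda>x. f x + t * g x) = (\<lambda>x. grad f x + t *\<^sub>R grad g x)"
    if "test_fun \<Omega> f" "test_fun \<Omega> g" for f g t
    using that by (auto simp: test_fun_def grad_linear)
  obtain \<psi> where \<psi>: "\<And>k. test_fun \<Omega> (\<psi> k)"
    and Cau: "\<And>e::real. e > 0 \<Longrightarrow> \<exists>N. \<forall>k\<ge>N. \<forall>l\<ge>N.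
        a (\<lambda>x. \<psi> k x + (-1) * \<psi> l x) (\<lambda>x. \<psi> k x + (-1) * \<psi> l x) \<le> e"
    and lim: "\<And>\<eta>. test_fun \<Omega> \<eta> \<Longrightarrow> (\<lambda>k. a (\<psi> k) \<eta>) \<longlonglongrightarrow> L \<eta>"
  proof (rule quadratic_functional_minimizing_sequence[of "{f. test_fun \<Omega> f}" a L "measure lebesgue \<Omega> / c"])
    show "{f. test_fun \<Omega> f} \<noteq> {}" using test_fun_zero by blast
    show "(\<lambda>x. f x + t * g x) \<in> {f. test_fun \<Omega> f}" if "f \<in> {f. test_fun \<Omega> f}" "g \<in> {f. test_fun \<Omega> f}" for f g t
      using that test_fun_linear by auto
    show "a (\<lambda>x. f x + t * g x) h = a f h + t * a g h"
      if "f \<in> {f. test_fun \<Omega> f}" "g \<in> {f. test_fun \<Omega> f}" "h \<in> {f. test_fun \<Omega> f}" for f g h t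
    proof -
      have t: "test_fun \<Omega> f" "test_fun \<Omega> g" "test_fun \<Omega> h" using that by auto
      show ?thesis unfolding a_def gl[OF t(1,2)]
        using sqint_inner[OF test_fun_sqint(2)[OF t(1)] test_fun_sqint(2)[OF t(3)]]
          sqint_inner[OF test_fun_sqint(2)[OF t(2)] test_fun_sqint(2)[OF t(3)]]
        by (simp add: inner_add_left)
    qed
    show "a f g = a g f" for f g by (simp add: a_def inner_commute)
    show "0 \<le> a f f" for f by (simp add: aa)
    show "L (\<lambda>x. f x + t * g x) = L f + t * L g"
      if "f \<in> {f. test_fun \<Omega> f}" "g \<in> {f. test_fun \<Omega> f}" for f g t
    proof -
      have t: "test_fun \<Omega> f" "test_fun \<Omega> g" using that by auto
      have "(\<integral>x. indicat_real \<Omega> x \<bullet> f x + t * (indicat_real \<Omega> x \<bullet> g x) \<partial>lebesgue) = L f + t * L g"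
        unfolding L_def
        using sqint_inner[OF ind test_fun_sqint(1)[OF t(1)]] sqint_inner[OF ind test_fun_sqint(1)[OF t(2)]]
        by (subst Bochner_Integration.integral_add) auto
      then show ?thesis by (simp add: L_def algebra_simps)
    qed
    \<comment> \<open>|\<Omega>| is the squared L^2 norm of the indicator, and 1/c comes from the
      Poincare inequality \<open>P\<close>.\<close>
    show "(L f)\<^sup>2 \<le> measure lebesgue \<Omega> / c * a f f" if "f \<in> {f. test_fun \<Omega> f}" for f
    proof -
      have t: "test_fun \<Omega> f" using that by simp
      have i: "(\<lambda>x. (norm (indicat_real \<Omega> x))\<^sup>2) = indicat_real \<Omega>" by (auto simp: indicator_def)
      have "(L f)\<^sup>2 \<le> measure lebesgue \<Omega> * (\<integral>x. (norm (f x))\<^sup>2 \<partial>lebesgue)"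
        using sqint_Cauchy_Schwarz[OF ind test_fun_sqint(1)[OF t]] unfolding i by (simp add: L_def)
      also have "\<dots> \<le> measure lebesgue \<Omega> * (a f f / c)"
        using P[OF t] c(1) by (intro mult_left_mono) (auto simp: field_simps)
      finally show ?thesis by simp
    qed
    show "0 \<le> measure lebesgue \<Omega> / c" using c by simp
  qed (auto intro: that)
  have dt: "test_fun \<Omega> (\<lambda>x. \<psi> k x + (-1) * \<psi> l x)" for k l by (rule test_fun_linear[OF \<psi> \<psi>])
  have nn2: "(\<integral>\<^sup>+x. ennreal ((norm (grad (\<psi> k) x - grad (\<psi> l) x))\<^sup>2) \<partial>lebesgue)
      = ennreal (a (\<lambda>x. \<psi> k x + (-1) * \<psi> l x) (\<lambda>x. \<psi> k x + (-1) * \<psi> l x))" for k l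
    using nn_integral_norm_sq[OF test_fun_sqint(2)[OF dt, of k l]] unfolding aa gl[OF \<psi> \<psi>] by simp
  have nn1: "(\<integral>\<^sup>+x. ennreal ((norm (\<psi> k x - \<psi> l x))\<^sup>2) \<partial>lebesgue)
      \<le> ennreal (a (\<lambda>x. \<psi> k x + (-1) * \<psi> l x) (\<lambda>x. \<psi> k x + (-1) * \<psi> l x) / c)" for k l
    using nn_integral_norm_sq[OF test_fun_sqint(1)[OF dt, of k l]] P[OF dt, of k l] c
    by (simp add: ennreal_leI field_simps)
  obtain G where G [measurable]: "G \<in> borel_measurable lebesgue"
    and Glim: "(\<lambda>k. \<integral>\<^sup>+x. ennreal ((norm (grad (\<psi> k) x - G x))\<^sup>2) \<partial>lebesgue) \<longlonglongrightarrow> 0"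
  proof (rule Riesz_Fischer_sq[of "\<lambda>k. grad (\<psi> k)" lebesgue])
    show "\<exists>N. \<forall>k\<ge>N. \<forall>l\<ge>N. (\<integral>\<^sup>+x. ennreal ((norm (grad (\<psi> k) x - grad (\<psi> l) x))\<^sup>2) \<partial>lebesgue) \<le> ennreal e"
      if "e > 0" for e
      using Cau[OF that] unfolding nn2 by (meson ennreal_leI)
    show "grad (\<psi> k) \<in> borel_measurable lebesgue" for k
      using test_fun_sqint(2)[OF \<psi>] by (simp add: sqint_def)
  qed
  obtain v where v [measurable]: "v \<in> borel_measurable lebesgue"
    and vlim: "(\<lambda>k. \<integral>\<^sup>+x. ennreal ((norm (\<psi> k x - v x))\<^sup>2) \<partial>lebesgue) \<longlonglongrightarrow> 0"
  proof (rule Riesz_Fischer_sq[of \<psi> lebesgue])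
    fix e :: real assume "e > 0"
    then have "c * e > 0" using c by simp
    from Cau[OF this] obtain N where N: "\<And>k l. k \<ge> N \<Longrightarrow> l \<ge> N \<Longrightarrow>
       a (\<lambda>x. \<psi> k x + (-1) * \<psi> l x) (\<lambda>x. \<psi> k x + (-1) * \<psi> l x) \<le> c * e" by blast
    have "(\<integral>\<^sup>+x. ennreal ((norm (\<psi> k x - \<psi> l x))\<^sup>2) \<partial>lebesgue) \<le> ennreal e" if "k \<ge> N" "l \<ge> N" for k l
      using N[OF that] c by (intro order_trans[OF nn1] ennreal_leI) (simp add: field_simps)
    then show "\<exists>N. \<forall>k\<ge>N. \<forall>l\<ge>N. (\<integral>\<^sup>+x. ennreal ((norm (\<psi> k x - \<psi> l x))\<^sup>2) \<partial>lebesgue) \<le> ennreal e" by blast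
  next
    show "\<psi> k \<in> borel_measurable lebesgue" for k
      using test_fun_sqint(1)[OF \<psi>] by (simp add: sqint_def)
  qed
  have H: "H01 \<Omega> v G"
    unfolding H01_def using \<psi> Glim vlim by (auto intro!: exI[of _ \<psi>])
  have G2: "sqint lebesgue G" by (rule H01_sqint(2)[OF H])
  have test: "(\<integral>x. grad \<eta> x \<bullet> G x \<partial>lebesgue) = L \<eta>" if "test_fun \<Omega> \<eta>" for \<eta>
  proof (rule LIMSEQ_unique)
    show "(\<lambda>k. \<integral>x. grad \<eta> x \<bullet> grad (\<psi> k) x \<partial>lebesgue) \<longlonglongrightarrow> (\<integral>x. grad \<eta> x \<bullet> G x \<partial>lebesgue)"
      by (rule sqint_inner_limit[OF test_fun_sqint(2)[OF that] test_fun_sqint(2)[OF \<psi>] G Glim])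
    show "(\<lambda>k. \<integral>x. grad \<eta> x \<bullet> grad (\<psi> k) x \<partial>lebesgue) \<longlonglongrightarrow> L \<eta>"
      using lim[OF that] by (simp add: a_def inner_commute)
  qed
  have "(\<integral>x\<in>\<Omega>. G x \<bullet> K x \<partial>lebesgue) = (\<integral>x\<in>\<Omega>. \<phi> x \<partial>lebesgue)" if "H01 \<Omega> \<phi> K" for \<phi> K
  proof -
    obtain \<eta> where \<eta>: "\<And>k. test_fun \<Omega> (\<eta> k)"
      "(\<lambda>k. \<integral>\<^sup>+ x. ennreal ((norm (\<eta> k x - \<phi> x))\<^sup>2) \<partial>lebesgue) \<longlonglongrightarrow> 0"
      "(\<lambda>k. \<integral>\<^sup>+ x. ennreal ((norm (grad (\<eta> k) x - K x))\<^sup>2) \<partial>lebesgue) \<longlonglongrightarrow> 0"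
      "\<phi> \<in> borel_measurable lebesgue" "K \<in> borel_measurable lebesgue"
      using \<open>H01 \<Omega> \<phi> K\<close> unfolding H01_def by auto
    \<comment> \<open>\<open>is_torsion\<close> integrates over \<Omega> only. Restricting
      \<open>G\<close> by the indicator avoids showing that the L^2 limit vanishes outside \<Omega>;
      the gradients of test functions do so anyway.\<close>
    have 1: "(\<lambda>k. \<integral>x. (indicat_real \<Omega> x *\<^sub>R G x) \<bullet> grad (\<eta> k) x \<partial>lebesgue)
        \<longlonglongrightarrow> (\<integral>x. (indicat_real \<Omega> x *\<^sub>R G x) \<bullet> K x \<partial>lebesgue)"
      by (rule sqint_inner_limit[OF sqint_restrict[OF G2 \<Omega>(1)] test_fun_sqint(2)[OF \<eta>(1)] \<eta>(5) \<eta>(3)])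
    have 2: "(\<integral>x. (indicat_real \<Omega> x *\<^sub>R G x) \<bullet> grad (\<eta> k) x \<partial>lebesgue) = L (\<eta> k)" for k
      unfolding test[OF \<eta>(1), symmetric] using test_fun_eq_0_outside(2)[OF \<eta>(1)]
      by (intro Bochner_Integration.integral_cong) (auto simp: indicator_def inner_commute)
    have 3: "(\<lambda>k. L (\<eta> k)) \<longlonglongrightarrow> (\<integral>x. indicat_real \<Omega> x \<bullet> \<phi> x \<partial>lebesgue)"
      unfolding L_def by (rule sqint_inner_limit[OF ind test_fun_sqint(1)[OF \<eta>(1)] \<eta>(4) \<eta>(2)])
    have "(\<integral>x. (indicat_real \<Omega> x *\<^sub>R G x) \<bullet> K x \<partial>lebesgue) = (\<integral>x. indicat_real \<Omega> x \<bullet> \<phi> x \<partial>lebesgue)"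
      using LIMSEQ_unique[OF 1[unfolded 2] 3] .
    then show ?thesis by (simp add: set_lebesgue_integral_def)
  qed
  with H show ?thesis unfolding is_torsion_def by blast
qed

section \<open>Chain rule in the Sobolev space\<close>

text \<open>The squared distances tend to 0 in L^1, which gives an almost everywhere convergent
  subsequence.\<close>

lemma sqint_limit_AE_subseq:
  assumes g: "\<And>k. sqint M (g k)" and h: "sqint M h"
    and lim: "(\<lambda>k. \<integral>\<^sup>+x. ennreal ((norm (g k x - h x))\<^sup>2) \<partial>M) \<longlonglongrightarrow> 0"
  obtains r :: "nat \<Rightarrow> nat" where "strict_mono r" "AE x in M. (\<lambda>k. g (r k) x) \<longlonglongrightarrow> h x"
proof -
  have d: "sqint M (\<lambda>x. g k x - h x)" for k by (rule sqint_diff[OF g h])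
  have "(\<lambda>k. \<integral>x. norm ((norm (g k x - h x))\<^sup>2) \<partial>M) \<longlonglongrightarrow> 0"
    using lim unfolding nn_integral_norm_sq[OF d] by (simp add: ennreal_0[symmetric] del: ennreal_0)
  then obtain r where r: "strict_mono r" "AE x in M. (\<lambda>n. (norm (g (r n) x - h x))\<^sup>2) \<longlonglongrightarrow> 0"
    using tendsto_L1_AE_subseq[of M "\<lambda>k x. (norm (g k x - h x))\<^sup>2"] d by (auto simp: sqint_def)
  from r(2) have "AE x in M. (\<lambda>k. g (r k) x) \<longlonglongrightarrow> h x"
    by eventually_elim (simp add: LIM_zero_iff tendsto_norm_zero_iff)
  with r(1) that show thesis by blast
qed

text \<open>The compositions \<open>g (\<psi> k x)\<close> are test functions again. The bound on
  \<open>g'\<close> makes \<open>g\<close> Lipschitz, which settles convergence of the functions.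
  For the gradients, continuity of \<open>g'\<close> is combined with dominated convergence.\<close>

lemma H01_comp:
  fixes \<Omega> :: "(real^'m) set"
  assumes H: "H01 \<Omega> v G" and g: "smooth_real g" "g 0 = 0" "\<And>t. DERIV g t :> g' t"
    and bd: "\<And>t. \<bar>g' t\<bar> \<le> B" and cont: "continuous_on UNIV g'"
  shows "H01 \<Omega> (\<lambda>x. g (v x)) (\<lambda>x. g' (v x) *\<^sub>R G x)"
proof -
  obtain \<psi>0 where \<psi>0: "\<And>k. test_fun \<Omega> (\<psi>0 k)"
    "(\<lambda>k. \<integral>\<^sup>+ x. ennreal ((norm (\<psi>0 k x - v x))\<^sup>2) \<partial>lebesgue) \<longlonglongrightarrow> 0"
    "(\<lambda>k. \<integral>\<^sup>+ x. ennreal ((norm (grad (\<psi>0 k) x - G x))\<^sup>2) \<partial>lebesgue) \<longlonglongrightarrow> 0"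
    using H unfolding H01_def by auto
  \<comment> \<open>L^2 convergence alone gives no pointwise control of
    \<open>g' (\<psi> k x)\<close>; a subsequence converges almost everywhere.\<close>
  obtain r where r: "strict_mono r" "AE x in lebesgue. (\<lambda>k. \<psi>0 (r k) x) \<longlonglongrightarrow> v x"
    using sqint_limit_AE_subseq[OF test_fun_sqint(1)[OF \<psi>0(1)] H01_sqint(1)[OF H] \<psi>0(2)] by blast
  define \<psi> where "\<psi> k = \<psi>0 (r k)" for k
  have \<psi>: "test_fun \<Omega> (\<psi> k)" for k unfolding \<psi>_def by (rule \<psi>0)
  have lim1: "(\<lambda>k. \<integral>\<^sup>+ x. ennreal ((norm (\<psi> k x - v x))\<^sup>2) \<partial>lebesgue) \<longlonglongrightarrow> 0"
    using LIMSEQ_subseq_LIMSEQ[OF \<psi>0(2) r(1)] by (simp add: \<psi>_def o_def)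
  have lim2: "(\<lambda>k. \<integral>\<^sup>+ x. ennreal ((norm (grad (\<psi> k) x - G x))\<^sup>2) \<partial>lebesgue) \<longlonglongrightarrow> 0"
    using LIMSEQ_subseq_LIMSEQ[OF \<psi>0(3) r(1)] by (simp add: \<psi>_def o_def)
  have ae: "AE x in lebesgue. (\<lambda>k. \<psi> k x) \<longlonglongrightarrow> v x" using r(2) by (simp add: \<psi>_def)
  have [measurable]: "v \<in> borel_measurable lebesgue" "G \<in> borel_measurable lebesgue"
    using H by (auto simp: H01_def)
  have [measurable]: "\<psi> k \<in> borel_measurable lebesgue" "grad (\<psi> k) \<in> borel_measurable lebesgue" for k
    using test_fun_sqint[OF \<psi>] by (auto simp: sqint_def)
  have [measurable]: "g \<in> borel_measurable borel" "g' \<in> borel_measurable borel"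
    using smooth_real_continuous[OF g(1)] cont by (auto intro: borel_measurable_continuous_onI)
  have B: "B \<ge> 0" using bd[of 0] by simp
  have lip: "\<bar>g s - g t\<bar> \<le> B * \<bar>s - t\<bar>" for s t
    using field_differentiable_bound[of UNIV g g' B s t] g(3) bd by (auto simp: has_field_derivative_at_within)
  have gr: "grad (\<lambda>x. g (\<psi> k x)) x = g' (\<psi> k x) *\<^sub>R grad (\<psi> k) x" for k x
    using \<psi>[of k] by (intro grad_comp g(3) smooth_fun_differentiable) (simp add: test_fun_def)
  have L1: "(\<lambda>k. \<integral>\<^sup>+ x. ennreal ((g (\<psi> k x) - g (v x))\<^sup>2) \<partial>lebesgue) \<longlonglongrightarrow> 0"
  proof (rule tendsto_sandwich[where f = "\<lambda>_. 0"])
    show "(\<lambda>k. ennreal (B\<^sup>2) * (\<integral>\<^sup>+ x. ennreal ((norm (\<psi> k x - v x))\<^sup>2) \<partial>lebesgue)) \<longlonglongrightarrow> 0"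
      using ennreal_tendsto_cmult[OF _ lim1, of "ennreal (B\<^sup>2)"] by simp
    have "(g s - g t)\<^sup>2 \<le> B\<^sup>2 * (norm (s - t))\<^sup>2" for s t
      using power_mono[OF lip[of s t], of 2] by (simp add: power_mult_distrib)
    then have "(\<integral>\<^sup>+ x. ennreal ((g (\<psi> k x) - g (v x))\<^sup>2) \<partial>lebesgue)
        \<le> (\<integral>\<^sup>+ x. ennreal (B\<^sup>2) * ennreal ((norm (\<psi> k x - v x))\<^sup>2) \<partial>lebesgue)" for k
      by (intro nn_integral_mono) (auto simp: ennreal_mult[symmetric] intro!: ennreal_leI)
    then show "\<forall>\<^sub>F k in sequentially. (\<integral>\<^sup>+ x. ennreal ((g (\<psi> k x) - g (v x))\<^sup>2) \<partial>lebesgue)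
        \<le> ennreal (B\<^sup>2) * (\<integral>\<^sup>+ x. ennreal ((norm (\<psi> k x - v x))\<^sup>2) \<partial>lebesgue)"
      by (simp add: nn_integral_cmult)
  qed auto
  \<comment> \<open>The error from freezing the gradient at \<open>G\<close>: the coefficients
    differ by at most 2B, so a multiple of |G|^2 is a majorant.\<close>
  have dom: "(\<lambda>k. \<integral>\<^sup>+ x. ennreal ((\<bar>g' (\<psi> k x) - g' (v x)\<bar> * norm (G x))\<^sup>2) \<partial>lebesgue) \<longlonglongrightarrow> (\<integral>\<^sup>+ x. 0 \<partial>(lebesgue :: (real^'m) measure))"
  proof (rule nn_integral_dominated_convergence[where w = "\<lambda>x. ennreal ((2 * B)\<^sup>2 * (norm (G x))\<^sup>2)"])
    have "\<bar>g' s - g' t\<bar> \<le> 2 * B" for s t using bd[of s] bd[of t] by linarith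
    then have "\<bar>g' s - g' t\<bar>\<^sup>2 \<le> (2 * B)\<^sup>2" for s t by (intro power_mono) auto
    then have "(\<bar>g' s - g' t\<bar> * n)\<^sup>2 \<le> (2 * B)\<^sup>2 * n\<^sup>2" for s t n
      unfolding power_mult_distrib[of "\<bar>_\<bar>"] by (intro mult_right_mono) auto
    then show "AE x in lebesgue. ennreal ((\<bar>g' (\<psi> k x) - g' (v x)\<bar> * norm (G x))\<^sup>2) \<le> ennreal ((2 * B)\<^sup>2 * (norm (G x))\<^sup>2)" for k
      by (intro AE_I2 ennreal_leI)
    have "integrable lebesgue (\<lambda>x. (2 * B)\<^sup>2 * (norm (G x))\<^sup>2)"
      using H01_sqint(2)[OF H] by (simp add: sqint_def)
    then show "(\<integral>\<^sup>+ x. ennreal ((2 * B)\<^sup>2 * (norm (G x))\<^sup>2) \<partial>lebesgue) < \<infinity>"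
      by (subst nn_integral_eq_integral) auto
    show "AE x in lebesgue. (\<lambda>k. ennreal ((\<bar>g' (\<psi> k x) - g' (v x)\<bar> * norm (G x))\<^sup>2)) \<longlonglongrightarrow> 0"
      using ae
    proof eventually_elim
      case (elim x)
      have "isCont g' (v x)" using cont by (simp add: continuous_on_eq_continuous_at)
      from isCont_tendsto_compose[OF this elim]
      have "(\<lambda>k. (\<bar>g' (\<psi> k x) - g' (v x)\<bar> * norm (G x))\<^sup>2) \<longlonglongrightarrow> (\<bar>g' (v x) - g' (v x)\<bar> * norm (G x))\<^sup>2"
        by (intro tendsto_intros)
      then show ?case by (simp add: ennreal_0[symmetric] del: ennreal_0)
    qed
  qed measurable
  have L2: "(\<lambda>k. \<integral>\<^sup>+ x. ennreal ((norm (grad (\<lambda>x. g (\<psi> k x)) x - g' (v x) *\<^sub>R G x))\<^sup>2) \<partial>lebesgue) \<longlonglongrightarrow> 0"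
  proof (rule tendsto_sandwich[where f = "\<lambda>_. 0"])
    let ?h = "\<lambda>k. ennreal (2 * B\<^sup>2) * (\<integral>\<^sup>+ x. ennreal ((norm (grad (\<psi> k) x - G x))\<^sup>2) \<partial>lebesgue)
      + ennreal 2 * (\<integral>\<^sup>+ x. ennreal ((\<bar>g' (\<psi> k x) - g' (v x)\<bar> * norm (G x))\<^sup>2) \<partial>lebesgue)"
    have "?h \<longlonglongrightarrow> ennreal (2 * B\<^sup>2) * 0 + ennreal 2 * 0"
      using dom by (intro tendsto_add ennreal_tendsto_cmult lim2) simp_all
    then show "?h \<longlonglongrightarrow> 0" by simp
    have "(norm (s *\<^sub>R a - t *\<^sub>R b))\<^sup>2 \<le> 2 * B\<^sup>2 * (norm (a - b))\<^sup>2 + 2 * (\<bar>s - t\<bar> * norm b)\<^sup>2"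
      if "\<bar>s\<bar> \<le> B" for s t and a b :: "real^'m"
    proof -
      \<comment> \<open>Splits the error into a gradient difference with bounded coefficient and a
        coefficient difference times the fixed \<open>G\<close>.\<close>
      have "s *\<^sub>R a - t *\<^sub>R b = s *\<^sub>R (a - b) + (s - t) *\<^sub>R b" by (simp add: algebra_simps)
      then have "(norm (s *\<^sub>R a - t *\<^sub>R b))\<^sup>2 \<le> 2 * (norm (s *\<^sub>R (a - b)))\<^sup>2 + 2 * (norm ((s - t) *\<^sub>R b))\<^sup>2"
        by (metis norm_add_sq_le)
      moreover have "(norm (s *\<^sub>R (a - b)))\<^sup>2 \<le> B\<^sup>2 * (norm (a - b))\<^sup>2"
        using that by (auto simp: power_mult_distrib abs_le_square_iff[symmetric] intro!: mult_right_mono)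
      ultimately show ?thesis by simp
    qed
    then have "(norm (grad (\<lambda>x. g (\<psi> k x)) x - g' (v x) *\<^sub>R G x))\<^sup>2
        \<le> 2 * B\<^sup>2 * (norm (grad (\<psi> k) x - G x))\<^sup>2 + 2 * (\<bar>g' (\<psi> k x) - g' (v x)\<bar> * norm (G x))\<^sup>2" for k x
      unfolding gr using bd by blast
    then have "(\<integral>\<^sup>+ x. ennreal ((norm (grad (\<lambda>x. g (\<psi> k x)) x - g' (v x) *\<^sub>R G x))\<^sup>2) \<partial>lebesgue)
      \<le> (\<integral>\<^sup>+ x. ennreal (2 * B\<^sup>2) * ennreal ((norm (grad (\<psi> k) x - G x))\<^sup>2)
         + ennreal 2 * ennreal ((\<bar>g' (\<psi> k x) - g' (v x)\<bar> * norm (G x))\<^sup>2) \<partial>lebesgue)" for k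
      by (intro nn_integral_mono) (simp add: ennreal_mult[symmetric] ennreal_plus[symmetric] ennreal_leI del: ennreal_plus ennreal_numeral)
    also have "\<And>k. (\<integral>\<^sup>+ x. ennreal (2 * B\<^sup>2) * ennreal ((norm (grad (\<psi> k) x - G x))\<^sup>2)
         + ennreal 2 * ennreal ((\<bar>g' (\<psi> k x) - g' (v x)\<bar> * norm (G x))\<^sup>2) \<partial>lebesgue) = ?h k"
      by (subst nn_integral_add) (auto simp: nn_integral_cmult)
    finally show "\<forall>\<^sub>F k in sequentially. (\<integral>\<^sup>+ x. ennreal ((norm (grad (\<lambda>x. g (\<psi> k x)) x - g' (v x) *\<^sub>R G x))\<^sup>2) \<partial>lebesgue) \<le> ?h k"
      by simp
  qed auto
  show ?thesis
    unfolding H01_def using L1 L2 test_fun_comp[OF \<psi> g(1,2)]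
    by (auto intro!: exI[of _ "\<lambda>k x. g (\<psi> k x)"])
qed

section \<open>Moments of the torsion function\<close>

text \<open>Taking \<open>h' = (g')^2\<close> makes the Dirichlet integral of g(v) coincide with the
  pairing of \<open>G\<close> and the gradient of h(v). The membership of g(v) is exported because
  its square integrability is needed again when bounds on the integral are compared.\<close>

lemma torsion_energy_inequality:
  fixes \<Omega> :: "(real^'m) set"
  assumes H: "H01 \<Omega> v G"
    and eq: "\<And>\<phi> K. H01 \<Omega> \<phi> K \<Longrightarrow> (\<integral>x\<in>\<Omega>. G x \<bullet> K x \<partial>lebesgue) = (\<integral>x\<in>\<Omega>. \<phi> x \<partial>lebesgue)"
    and P: "poincare \<Omega> c"
    and w: "smooth_real w" "\<And>t. \<bar>w t\<bar> \<le> B"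
    and g: "\<And>t. DERIV g t :> w t" "g 0 = 0"
    and h: "\<And>t. DERIV h t :> (w t)\<^sup>2" "h 0 = 0"
  shows "H01 \<Omega> (\<lambda>x. g (v x)) (\<lambda>x. w (v x) *\<^sub>R G x)"
    "c * (\<integral>x\<in>\<Omega>. (g (v x))\<^sup>2 \<partial>lebesgue) \<le> (\<integral>x\<in>\<Omega>. h (v x) \<partial>lebesgue)"
proof -
  have cw: "continuous_on UNIV w" by (rule smooth_real_continuous[OF w(1)])
  have w2: "smooth_real (\<lambda>t. (w t)\<^sup>2)"
    unfolding power2_eq_square by (rule smooth_real_mult[OF w(1) w(1)])
  have b2: "\<bar>(w t)\<^sup>2\<bar> \<le> B\<^sup>2" for t using power_mono[OF w(2)[of t], of 2] by simp
  show g': "H01 \<Omega> (\<lambda>x. g (v x)) (\<lambda>x. w (v x) *\<^sub>R G x)"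
    by (rule H01_comp[OF H smooth_real_antiderivative[OF w(1) g(1)] g(2) g(1) w(2) cw])
  have h': "H01 \<Omega> (\<lambda>x. h (v x)) (\<lambda>x. (w (v x))\<^sup>2 *\<^sub>R G x)"
    by (rule H01_comp[OF H smooth_real_antiderivative[OF w2 h(1)] h(2) h(1) b2 smooth_real_continuous[OF w2]])
  have "c * (\<integral>x\<in>\<Omega>. (g (v x))\<^sup>2 \<partial>lebesgue) \<le> (\<integral>x\<in>\<Omega>. (norm (w (v x) *\<^sub>R G x))\<^sup>2 \<partial>lebesgue)"
    using P g' unfolding poincare_def by blast
  also have "\<dots> = (\<integral>x\<in>\<Omega>. G x \<bullet> ((w (v x))\<^sup>2 *\<^sub>R G x) \<partial>lebesgue)"
    by (simp add: power_mult_distrib power2_norm_eq_inner)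
  also have "\<dots> = (\<integral>x\<in>\<Omega>. h (v x) \<partial>lebesgue)" by (rule eq[OF h'])
  finally show "c * (\<integral>x\<in>\<Omega>. (g (v x))\<^sup>2 \<partial>lebesgue) \<le> (\<integral>x\<in>\<Omega>. h (v x) \<partial>lebesgue)" .
qed

section \<open>Regularised power weights and their antiderivatives\<close>

lemma antiderivative_exists:
  fixes f :: "real \<Rightarrow> real"
  assumes "continuous_on UNIV f"
  obtains F where "\<And>x. DERIV F x :> f x" "F 0 = 0"
proof -
  have "\<exists>F. \<forall>x::real. (-\<infinity>::ereal) < x \<longrightarrow> x < (\<infinity>::ereal) \<longrightarrow> (F has_vector_derivative f x) (at x)"
    using assms by (intro einterval_antiderivative) (auto simp: continuous_on_eq_continuous_at)
  then obtain F where F: "\<And>x. DERIV F x :> f x"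
    by (auto simp: has_real_derivative_iff_has_vector_derivative)
  show thesis
    \<comment> \<open>The normalisation at 0 is what composition with compactly supported functions
      requires.\<close>
    by (rule that[of "\<lambda>x. F x - F 0"]) (auto intro!: derivative_eq_intros F)
qed

text \<open>Smooth bounded approximation, as \<open>e \<rightarrow> 0\<close>, of \<open>(n/2) |t|^(n/2 - 1)\<close> with \<open>n = N + 2\<close>: adding \<open>e\<^sup>2\<close>
  removes the singularity at 0, and dividing by the power of \<open>1 + e t\<^sup>2\<close> makes it bounded. The
  factor \<open>1\<close> puts both bases in the form \<open>c + b t\<^sup>2\<close>.\<close>
definition power_weight :: "nat \<Rightarrow> real \<Rightarrow> real \<Rightarrow> real" where
  "power_weight N e t = (real N + 2) / 2 * ((e\<^sup>2 + 1 * t\<^sup>2) powr (real N / 4) * (1 + e * t\<^sup>2) powr (- (real N / 4)))"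

lemma power_weight_smooth: "e > 0 \<Longrightarrow> smooth_real (power_weight N e)"
  unfolding power_weight_def smooth_real_def
  by (intro allI Ck_real_mult Ck_real_const Ck_real_quadratic_powr) auto

lemma power_weight_nonneg: "power_weight N e t \<ge> 0"
  by (simp add: power_weight_def)

lemma power_weight_even: "power_weight N e (- t) = power_weight N e t"
  by (simp add: power_weight_def)

text \<open>Rests on e^2 + t^2 \<le> (1/e)(1 + e t^2). The bound explodes as e tends to 0, but only
  its finiteness for each e is used.\<close>

lemma power_weight_bounded:
  assumes "0 < e" "e \<le> 1"
  shows "\<bar>power_weight N e t\<bar> \<le> (real N + 2) / 2 * (1 / e) powr (real N / 4)"
proof -
  have p: "1 + e * t\<^sup>2 > 0" using assms by (simp add: add_pos_nonneg)
  \<comment> \<open>Here \<open>e \<le> 1\<close> enters.\<close>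
  have "e\<^sup>2 \<le> 1 / e"
  proof -
    have "e\<^sup>2 \<le> 1" using assms by (simp add: power_le_one)
    also have "1 \<le> 1 / e" using assms by simp
    finally show ?thesis .
  qed
  then have "e\<^sup>2 + 1 * t\<^sup>2 \<le> (1 / e) * (1 + e * t\<^sup>2)" using assms by (simp add: field_simps)
  then have "(e\<^sup>2 + 1 * t\<^sup>2) powr (real N / 4) \<le> ((1 / e) * (1 + e * t\<^sup>2)) powr (real N / 4)"
    by (intro powr_mono2) auto
  also have "\<dots> = (1 / e) powr (real N / 4) * (1 + e * t\<^sup>2) powr (real N / 4)"
    by (rule powr_mult)
  finally have "(e\<^sup>2 + 1 * t\<^sup>2) powr (real N / 4) * (1 + e * t\<^sup>2) powr (- (real N / 4))
      \<le> (1 / e) powr (real N / 4) * (1 + e * t\<^sup>2) powr (real N / 4) * (1 + e * t\<^sup>2) powr (- (real N / 4))"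
    by (intro mult_right_mono) auto
  also have "\<dots> = (1 / e) powr (real N / 4)"
    using p by (simp add: powr_minus)
  finally have "power_weight N e t \<le> (real N + 2) / 2 * (1 / e) powr (real N / 4)"
    unfolding power_weight_def by (intro mult_left_mono) auto
  then show ?thesis using power_weight_nonneg[of N e t] by simp
qed

text \<open>The damping factor is at most 1 and e^2 + t^2 \<le> (|t| + e)^2. The shifted power is
  chosen because it has an elementary antiderivative.\<close>

lemma power_weight_sq_upper:
  assumes "0 < e"
  shows "(power_weight N e t)\<^sup>2 \<le> (real N + 2)\<^sup>2 / 4 * (\<bar>t\<bar> + e) ^ N"
proof -
  have p: "\<bar>t\<bar> + e > 0" using assms by simp
  have "(1 + e * t\<^sup>2) powr (- (real N / 4)) \<le> 1 powr (- (real N / 4))"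
    using assms by (intro powr_mono2') auto
  moreover have "(e\<^sup>2 + 1 * t\<^sup>2) powr (real N / 4) \<le> ((\<bar>t\<bar> + e)\<^sup>2) powr (real N / 4)"
    using assms by (intro powr_mono2) (auto simp: power2_sum)
  ultimately have "(e\<^sup>2 + 1 * t\<^sup>2) powr (real N / 4) * (1 + e * t\<^sup>2) powr (- (real N / 4))
     \<le> ((\<bar>t\<bar> + e)\<^sup>2) powr (real N / 4) * 1"
    by (intro mult_mono) auto
  then have "power_weight N e t \<le> (real N + 2) / 2 * ((\<bar>t\<bar> + e)\<^sup>2) powr (real N / 4)"
    unfolding power_weight_def by (intro mult_left_mono) auto
  then have "(power_weight N e t)\<^sup>2 \<le> ((real N + 2) / 2 * ((\<bar>t\<bar> + e)\<^sup>2) powr (real N / 4))\<^sup>2"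
    by (intro power_mono power_weight_nonneg)
  also have "\<dots> = (real N + 2)\<^sup>2 / 4 * (((\<bar>t\<bar> + e)\<^sup>2) powr (real N / 4))\<^sup>2"
    by (simp add: power_mult_distrib power_divide)
  also have "(((\<bar>t\<bar> + e)\<^sup>2) powr (real N / 4))\<^sup>2 = (\<bar>t\<bar> + e) powr real N"
  proof -
    have "((\<bar>t\<bar> + e)\<^sup>2) powr (real N / 4) = (\<bar>t\<bar> + e) powr (real N / 2)"
      using powr_powr[of "\<bar>t\<bar> + e" 2 "real N / 4"] p by simp
    then show ?thesis using p by (simp add: powr_power)
  qed
  also have "\<dots> = (\<bar>t\<bar> + e) ^ N" using p by (simp add: powr_realpow)
  finally show ?thesis .
qed

text \<open>The damping factor is frozen at the right endpoint \<open>t\<close>, where it is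
  smallest, so that it becomes a constant when integrating in \<open>s\<close>.\<close>

lemma power_weight_lower:
  assumes "0 < e" "0 < s" "s \<le> t"
  shows "(real N + 2) / 2 * s powr (real N / 2) * (1 + e * t\<^sup>2) powr (- (real N / 4)) \<le> power_weight N e s"
proof -
  have "s powr (real N / 2) = (s\<^sup>2) powr (real N / 4)"
  proof -
    have "s\<^sup>2 = s powr 2" using assms by (simp add: powr_numeral)
    then show ?thesis by (simp add: powr_powr)
  qed
  also have "\<dots> \<le> (e\<^sup>2 + 1 * s\<^sup>2) powr (real N / 4)" by (intro powr_mono2) auto
  finally have 1: "s powr (real N / 2) \<le> (e\<^sup>2 + 1 * s\<^sup>2) powr (real N / 4)" .
  have 2: "(1 + e * t\<^sup>2) powr (- (real N / 4)) \<le> (1 + e * s\<^sup>2) powr (- (real N / 4))"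
    using assms by (intro powr_mono2') (auto intro!: mult_left_mono power_mono add_pos_nonneg)
  show ?thesis
    unfolding power_weight_def mult.assoc by (intro mult_left_mono mult_mono 1 2) auto
qed

lemma power_weight_antiderivative_lower_nonneg:
  assumes e: "0 < e" and g: "\<And>t. DERIV g t :> power_weight N e t" "g 0 = 0" and t: "t \<ge> 0"
  shows "t powr ((real N + 2) / 2) * (1 + e * t\<^sup>2) powr (- (real N / 4)) \<le> g t"
proof -
  define K where "K = (1 + e * t\<^sup>2) powr (- (real N / 4))"
  have "g 0 - 0 powr ((real N + 2) / 2) * K \<le> g t - t powr ((real N + 2) / 2) * K"
  \<comment> \<open>The open-interval version is used because the derivative rule for
    \<open>powr\<close> needs a positive base; continuity covers the endpoint 0.\<close>
  proof (rule DERIV_nonneg_imp_increasing_open[OF t])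
    fix s assume s: "0 < s" "s < t"
    have "DERIV (\<lambda>s. g s - s powr ((real N + 2) / 2) * K) s :>
        power_weight N e s - (real N + 2) / 2 * s powr ((real N + 2) / 2 - 1) * K"
      using s by (auto intro!: derivative_eq_intros g)
    moreover have "(real N + 2) / 2 - 1 = real N / 2" by (simp add: field_simps)
    moreover have "(real N + 2) / 2 * s powr (real N / 2) * K \<le> power_weight N e s"
      unfolding K_def using e s by (intro power_weight_lower) auto
    ultimately show "\<exists>y. DERIV (\<lambda>s. g s - s powr ((real N + 2) / 2) * K) s :> y \<and> 0 \<le> y"
      by (metis diff_ge_0_iff_ge)
  next
    have "continuous_on {0..t} g"
      using g(1) by (auto intro!: continuous_at_imp_continuous_on DERIV_isCont)
    moreover have "continuous_on {0..t} (\<lambda>s. s powr ((real N + 2) / 2))"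
      by (intro continuous_on_powr' continuous_intros) auto
    ultimately show "continuous_on {0..t} (\<lambda>s. g s - s powr ((real N + 2) / 2) * K)"
      by (intro continuous_on_diff continuous_on_mult continuous_on_const)
  qed
  then show ?thesis using g(2) by (simp add: K_def)
qed

text \<open>The weight is even, so reflecting \<open>g\<close> gives another antiderivative
  vanishing at 0 and reduces negative \<open>t\<close> to the nonnegative case. Squaring turns the
  exponent N/4 into N/2.\<close>

lemma power_weight_antiderivative_lower:
  assumes e: "0 < e" and g: "\<And>t. DERIV g t :> power_weight N e t" "g 0 = 0"
  shows "\<bar>t\<bar> ^ (N + 2) * (1 + e * t\<^sup>2) powr (- (real N / 2)) \<le> (g t)\<^sup>2"
proof -
  have "\<bar>t\<bar> powr ((real N + 2) / 2) * (1 + e * t\<^sup>2) powr (- (real N / 4)) \<le> \<bar>g t\<bar>"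
  proof (cases "t \<ge> 0")
    case True
    then show ?thesis
      using power_weight_antiderivative_lower_nonneg[OF e g True] by simp
  next
    case False
    have "DERIV (\<lambda>s. - g (- s)) s :> power_weight N e s" for s
      by (auto intro!: derivative_eq_intros DERIV_chain2[OF g(1)] simp: power_weight_even)
    from power_weight_antiderivative_lower_nonneg[OF e this, of "- t"]
    show ?thesis using False g(2) by simp
  qed
  then have "(\<bar>t\<bar> powr ((real N + 2) / 2) * (1 + e * t\<^sup>2) powr (- (real N / 4)))\<^sup>2 \<le> \<bar>g t\<bar>\<^sup>2"
    by (intro power_mono) auto
  moreover have "(\<bar>t\<bar> powr ((real N + 2) / 2))\<^sup>2 = \<bar>t\<bar> ^ (N + 2)"
  proof (cases "t = 0")
    case False
    then have "(\<bar>t\<bar> powr ((real N + 2) / 2))\<^sup>2 = \<bar>t\<bar> powr real (N + 2)"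
      by (simp add: power2_eq_square powr_add[symmetric] add.commute)
    then show ?thesis using False by (subst (asm) powr_realpow) auto
  qed simp
  moreover have "((1 + e * t\<^sup>2) powr (- (real N / 4)))\<^sup>2 = (1 + e * t\<^sup>2) powr (- (real N / 2))"
  proof -
    have "1 + e * t\<^sup>2 > 0" using e by (simp add: add_pos_nonneg)
    then show ?thesis by (simp add: powr_power field_simps)
  qed
  ultimately show ?thesis by (simp add: power_mult_distrib)
qed

text \<open>For \<open>t \<ge> 0\<close> the bound on the squared weight is integrated; integrating
  the N-th power supplies the divisor N + 1. For negative \<open>t\<close> the left side is at most
  0.\<close>

lemma power_weight_sq_antiderivative_upper:
  assumes e: "0 < e" and h: "\<And>t. DERIV h t :> (power_weight N e t)\<^sup>2" "h 0 = 0"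
  shows "h t \<le> (real N + 2)\<^sup>2 / (4 * (real N + 1)) * (\<bar>t\<bar> + e) ^ (N + 1)"
proof (cases "t \<ge> 0")
  case True
  define C where "C = (real N + 2)\<^sup>2 / (4 * (real N + 1))"
  have C: "C * (real N + 1) = (real N + 2)\<^sup>2 / 4" by (simp add: C_def field_simps)
  have "C * (0 + e) ^ (N + 1) - h 0 \<le> C * (t + e) ^ (N + 1) - h t"
  proof (rule DERIV_nonneg_imp_nondecreasing[OF True])
    fix s assume s: "0 \<le> s" "s \<le> t"
    have "DERIV (\<lambda>s. C * (s + e) ^ (N + 1) - h s) s :> C * (real N + 1) * (s + e) ^ N - (power_weight N e s)\<^sup>2"
    proof -
      have "DERIV (\<lambda>s. (s + e) ^ (N + 1)) s :> (real N + 1) * (s + e) ^ N"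
        by (rule DERIV_cong[OF DERIV_power[OF DERIV_add[OF DERIV_ident DERIV_const]]]) simp
      from DERIV_diff[OF DERIV_cmult[OF this, of C] h(1)] show ?thesis by (simp only: mult.assoc)
    qed
    moreover have "(power_weight N e s)\<^sup>2 \<le> C * (real N + 1) * (s + e) ^ N"
      unfolding C using power_weight_sq_upper[OF e, of N s] s by simp
    ultimately show "\<exists>y. DERIV (\<lambda>s. C * (s + e) ^ (N + 1) - h s) s :> y \<and> 0 \<le> y"
      by (metis diff_ge_0_iff_ge)
  qed
  moreover have "C * (0 + e) ^ (N + 1) \<ge> 0" using e by (simp add: C_def)
  ultimately have "h t \<le> C * (t + e) ^ (N + 1)" unfolding h(2) by argo
  then show ?thesis using True by (simp add: C_def)
next
  case False
  have "\<exists>y. DERIV h x :> y \<and> 0 \<le> y" for x using h(1)[of x] zero_le_power2 by blast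
  moreover have "t \<le> 0" using False by simp
  ultimately have "h t \<le> h 0" by (rule DERIV_nonneg_imp_nondecreasing[rotated])
  also have "\<dots> \<le> (real N + 2)\<^sup>2 / (4 * (real N + 1)) * (\<bar>t\<bar> + e) ^ (N + 1)"
    using h(2) e by simp
  finally show ?thesis .
qed

section \<open>Recursion and induction for the moments\<close>

lemma sqint_imp_set_integrable:
  fixes f :: "'a \<Rightarrow> real"
  assumes "sqint M f" "A \<in> sets M" "emeasure M A < \<infinity>"
  shows "set_integrable M A f"
  using sqint_inner[OF sqint_indicator[OF assms(2,3)] assms(1)] by (simp add: set_integrable_def)

lemma sqint_imp_set_integrable_sq:
  fixes f :: "'a \<Rightarrow> real"
  assumes "sqint M f" "A \<in> sets M"
  shows "set_integrable M A (\<lambda>x. (f x)\<^sup>2)"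
  using assms unfolding set_integrable_def
  by (intro integrable_mult_indicator) (auto simp: sqint_def)

text \<open>Both summands are at most max a 1. This gives a majorant independent of the
  regularisation parameter \<open>b \<le> 1\<close>.\<close>

lemma add_power_le:
  fixes a b :: real
  assumes "0 \<le> a" "0 \<le> b" "b \<le> 1"
  shows "(a + b) ^ n \<le> 2 ^ n * (a ^ n + 1)"
proof -
  have "(a + b) ^ n \<le> (2 * max a 1) ^ n" using assms by (intro power_mono) auto
  also have "\<dots> = 2 ^ n * (max a 1) ^ n" by (simp add: power_mult_distrib)
  also have "(max a 1) ^ n \<le> a ^ n + 1" using assms by (auto simp: max_def)
  finally show ?thesis by simp
qed

text \<open>This is the case n = N + 2 of the recursion. Every estimate is made at a fixed parameter
  \<open>e j\<close>, where the weight is admissible. In the limit the lower moment dominates the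
  right side, and Fatou yields integrability and the inequality together.\<close>

lemma torsion_moment_step:
  fixes \<Omega> :: "(real^'m) set"
  assumes \<Omega>: "\<Omega> \<in> sets lebesgue" "emeasure lebesgue \<Omega> < \<infinity>"
    and H: "H01 \<Omega> v G"
    and eq: "\<And>\<phi> K. H01 \<Omega> \<phi> K \<Longrightarrow> (\<integral>x\<in>\<Omega>. G x \<bullet> K x \<partial>lebesgue) = (\<integral>x\<in>\<Omega>. \<phi> x \<partial>lebesgue)"
    and P: "poincare \<Omega> c" "c > 0"
    and int: "set_integrable lebesgue \<Omega> (\<lambda>x. \<bar>v x\<bar> ^ (N + 1))"
  shows "set_integrable lebesgue \<Omega> (\<lambda>x. \<bar>v x\<bar> ^ (N + 2))"
    "c * (\<integral>x\<in>\<Omega>. \<bar>v x\<bar> ^ (N + 2) \<partial>lebesgue)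
       \<le> (real N + 2)\<^sup>2 / (4 * (real N + 1)) * (\<integral>x\<in>\<Omega>. \<bar>v x\<bar> ^ (N + 1) \<partial>lebesgue)"
proof -
  define e where "e j = 1 / real (Suc j)" for j
  have e: "0 < e j" "e j \<le> 1" for j by (auto simp: e_def)
  have elim: "e \<longlonglongrightarrow> 0"
    unfolding e_def using LIMSEQ_inverse_real_of_nat by (simp add: inverse_eq_divide)
  define C where "C = (real N + 2)\<^sup>2 / (4 * (real N + 1))"
  have C: "C \<ge> 0" by (simp add: C_def)
  have [measurable]: "v \<in> borel_measurable lebesgue" "\<Omega> \<in> sets lebesgue"
    using H \<Omega> by (auto simp: H01_def)
  define I where "I t = (\<integral>x\<in>\<Omega>. (\<bar>v x\<bar> + t) ^ (N + 1) \<partial>lebesgue)" for t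
  have dom: "integrable lebesgue (\<lambda>x. 2 ^ (N + 1) * (indicator \<Omega> x *\<^sub>R \<bar>v x\<bar> ^ (N + 1) + indicator \<Omega> x))"
    using int \<Omega> by (auto simp: set_integrable_def)
  have le: "norm (indicator \<Omega> x *\<^sub>R (\<bar>v x\<bar> + t) ^ (N + 1)) \<le> 2 ^ (N + 1) * (indicator \<Omega> x *\<^sub>R \<bar>v x\<bar> ^ (N + 1) + indicator \<Omega> x)"
    if "0 \<le> t" "t \<le> 1" for t x
    using add_power_le[of "\<bar>v x\<bar>" t "N + 1"] that by (auto simp: indicator_def)
  have inte: "set_integrable lebesgue \<Omega> (\<lambda>x. (\<bar>v x\<bar> + e j) ^ (N + 1))" for j
    unfolding set_integrable_def
    by (rule Bochner_Integration.integrable_bound[OF dom]) (use le[of "e j"] e[of j] in \<open>auto intro: order_trans\<close>)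
  have Ilim: "(\<lambda>j. I (e j)) \<longlonglongrightarrow> (\<integral>x\<in>\<Omega>. \<bar>v x\<bar> ^ (N + 1) \<partial>lebesgue)"
    unfolding I_def set_lebesgue_integral_def
  proof (rule integral_dominated_convergence[OF _ _ dom])
    show "AE x in lebesgue. (\<lambda>j. indicator \<Omega> x *\<^sub>R (\<bar>v x\<bar> + e j) ^ (N + 1)) \<longlonglongrightarrow> indicator \<Omega> x *\<^sub>R \<bar>v x\<bar> ^ (N + 1)"
    proof (rule AE_I2)
      fix x
      have "(\<lambda>j. indicat_real \<Omega> x *\<^sub>R (\<bar>v x\<bar> + e j) ^ (N + 1)) \<longlonglongrightarrow> indicator \<Omega> x *\<^sub>R (\<bar>v x\<bar> + 0) ^ (N + 1)"
        by (intro tendsto_intros elim)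
      then show "(\<lambda>j. indicat_real \<Omega> x *\<^sub>R (\<bar>v x\<bar> + e j) ^ (N + 1)) \<longlonglongrightarrow> indicator \<Omega> x *\<^sub>R \<bar>v x\<bar> ^ (N + 1)" by simp
    qed
    show "AE x in lebesgue. norm (indicator \<Omega> x *\<^sub>R (\<bar>v x\<bar> + e j) ^ (N + 1)) \<le> 2 ^ (N + 1) * (indicator \<Omega> x *\<^sub>R \<bar>v x\<bar> ^ (N + 1) + indicator \<Omega> x)" for j
      using le[of "e j"] e[of j] by auto
  qed measurable
  \<comment> \<open>The lower bound for g(v)^2 at parameter \<open>e j\<close>; it converges
    pointwise to the wanted power as the damping disappears.\<close>
  define f where "f j x = \<bar>v x\<bar> ^ (N + 2) * (1 + e j * (v x)\<^sup>2) powr (- (real N / 2))" for j x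
  have bound: "(\<integral>\<^sup>+x\<in>\<Omega>. ennreal (f j x) \<partial>lebesgue) \<le> ennreal (C * I (e j) / c)" for j
  proof -
    note sm = power_weight_smooth[OF e(1)[of j], of N]
    obtain g where g: "\<And>t. DERIV g t :> power_weight N (e j) t" "g 0 = 0"
      using antiderivative_exists[OF smooth_real_continuous[OF sm]] by blast
    have "continuous_on UNIV (\<lambda>t. (power_weight N (e j) t)\<^sup>2)"
      by (intro continuous_intros smooth_real_continuous[OF sm])
    then obtain h where h: "\<And>t. DERIV h t :> (power_weight N (e j) t)\<^sup>2" "h 0 = 0"
      using antiderivative_exists by blast
    note E = torsion_energy_inequality[OF H eq P(1) sm power_weight_bounded[OF e] g h]
    have ig: "set_integrable lebesgue \<Omega> (\<lambda>x. (g (v x))\<^sup>2)"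
      by (rule sqint_imp_set_integrable_sq[OF H01_sqint(1)[OF E(1)] \<Omega>(1)])
    have "continuous_on UNIV h"
      using h(1) by (auto intro!: continuous_at_imp_continuous_on DERIV_isCont)
    then have [measurable]: "h \<in> borel_measurable borel" by (rule borel_measurable_continuous_onI)
    \<comment> \<open>\<open>integral_mono'\<close> asks for integrability of the nonnegative
      majorant only, so none has to be shown for h(v).\<close>
    have "(\<integral>x\<in>\<Omega>. h (v x) \<partial>lebesgue) \<le> (\<integral>x\<in>\<Omega>. C * (\<bar>v x\<bar> + e j) ^ (N + 1) \<partial>lebesgue)"
      unfolding set_lebesgue_integral_def
    proof (rule integral_mono')
      show "integrable lebesgue (\<lambda>x. indicator \<Omega> x *\<^sub>R (C * (\<bar>v x\<bar> + e j) ^ (N + 1)))"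
        using set_integrable_mult_right[OF inte[of j], of C] by (simp add: set_integrable_def)
      show "indicator \<Omega> x *\<^sub>R h (v x) \<le> indicator \<Omega> x *\<^sub>R (C * (\<bar>v x\<bar> + e j) ^ (N + 1))" for x
        unfolding C_def using power_weight_sq_antiderivative_upper[OF e(1) h, of "v x"]
        by (auto simp: indicator_def)
      show "0 \<le> indicator \<Omega> x *\<^sub>R (C * (\<bar>v x\<bar> + e j) ^ (N + 1))" for x
        using C e(1)[of j] by (auto simp: indicator_def)
    qed
    also have "\<dots> = C * I (e j)" unfolding I_def by simp
    finally have "c * (\<integral>x\<in>\<Omega>. (g (v x))\<^sup>2 \<partial>lebesgue) \<le> C * I (e j)" using E(2) by linarith
    then have le': "(\<integral>x\<in>\<Omega>. (g (v x))\<^sup>2 \<partial>lebesgue) \<le> C * I (e j) / c"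
      using P(2) by (simp add: field_simps)
    have "(\<integral>\<^sup>+x\<in>\<Omega>. ennreal (f j x) \<partial>lebesgue) \<le> (\<integral>\<^sup>+x. ennreal (indicator \<Omega> x *\<^sub>R (g (v x))\<^sup>2) \<partial>lebesgue)"
      unfolding f_def using power_weight_antiderivative_lower[OF e(1) g]
      by (intro nn_integral_mono) (auto simp: indicator_def intro!: ennreal_leI)
    also have "\<dots> = ennreal (\<integral>x\<in>\<Omega>. (g (v x))\<^sup>2 \<partial>lebesgue)"
      using ig unfolding set_integrable_def set_lebesgue_integral_def
      by (intro nn_integral_eq_integral) auto
    also have "\<dots> \<le> ennreal (C * I (e j) / c)" by (intro ennreal_leI le')
    finally show ?thesis .
  qed
  have "(\<integral>\<^sup>+x\<in>\<Omega>. ennreal (\<bar>v x\<bar> ^ (N + 2)) \<partial>lebesgue) = (\<integral>\<^sup>+x. liminf (\<lambda>j. ennreal (f j x) * indicator \<Omega> x) \<partial>lebesgue)"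
  proof (rule nn_integral_cong)
    fix x
    have "(\<lambda>j. f j x * indicat_real \<Omega> x) \<longlonglongrightarrow> \<bar>v x\<bar> ^ (N + 2) * (1 + 0 * (v x)\<^sup>2) powr (- (real N / 2)) * indicat_real \<Omega> x"
      unfolding f_def by (intro tendsto_intros elim) auto
    then have "(\<lambda>j. ennreal (f j x * indicat_real \<Omega> x)) \<longlonglongrightarrow> ennreal (\<bar>v x\<bar> ^ (N + 2) * indicat_real \<Omega> x)"
      by (intro tendsto_ennrealI) simp
    from lim_imp_Liminf[OF _ this]
    show "ennreal (\<bar>v x\<bar> ^ (N + 2)) * indicator \<Omega> x = liminf (\<lambda>j. ennreal (f j x) * indicator \<Omega> x)"
      by (cases "x \<in> \<Omega>") auto
  qed
  also have "\<dots> \<le> liminf (\<lambda>j. \<integral>\<^sup>+x\<in>\<Omega>. ennreal (f j x) \<partial>lebesgue)"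
    unfolding f_def by (intro nn_integral_liminf) measurable
  also have "\<dots> \<le> liminf (\<lambda>j. ennreal (C * I (e j) / c))"
    by (intro Liminf_mono always_eventually allI bound)
  also have "\<dots> = ennreal (C * (\<integral>x\<in>\<Omega>. \<bar>v x\<bar> ^ (N + 1) \<partial>lebesgue) / c)"
    using P(2) by (intro lim_imp_Liminf tendsto_ennrealI tendsto_intros Ilim) auto
  finally have fin: "(\<integral>\<^sup>+x\<in>\<Omega>. ennreal (\<bar>v x\<bar> ^ (N + 2)) \<partial>lebesgue) \<le> ennreal (C * (\<integral>x\<in>\<Omega>. \<bar>v x\<bar> ^ (N + 1) \<partial>lebesgue) / c)" .
  have conv: "(\<integral>\<^sup>+x\<in>\<Omega>. ennreal (\<bar>v x\<bar> ^ (N + 2)) \<partial>lebesgue) = (\<integral>\<^sup>+x. ennreal (indicator \<Omega> x *\<^sub>R \<bar>v x\<bar> ^ (N + 2)) \<partial>lebesgue)"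
    by (intro nn_integral_cong) (auto simp: indicator_def)
  show int': "set_integrable lebesgue \<Omega> (\<lambda>x. \<bar>v x\<bar> ^ (N + 2))"
    unfolding set_integrable_def
  proof (rule integrableI_nonneg)
    show "(\<integral>\<^sup>+x. ennreal (indicator \<Omega> x *\<^sub>R \<bar>v x\<bar> ^ (N + 2)) \<partial>lebesgue) < \<infinity>"
      using fin unfolding conv by (auto simp: less_top[symmetric] top_unique)
  qed auto
  have "ennreal (\<integral>x\<in>\<Omega>. \<bar>v x\<bar> ^ (N + 2) \<partial>lebesgue) \<le> ennreal (C * (\<integral>x\<in>\<Omega>. \<bar>v x\<bar> ^ (N + 1) \<partial>lebesgue) / c)"
    using fin int' unfolding conv set_integrable_def set_lebesgue_integral_def
    by (subst (asm) nn_integral_eq_integral) auto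
  moreover have "0 \<le> C * (\<integral>x\<in>\<Omega>. \<bar>v x\<bar> ^ (N + 1) \<partial>lebesgue) / c"
    using C P(2) unfolding set_lebesgue_integral_def
    by (intro divide_nonneg_pos mult_nonneg_nonneg integral_nonneg_AE) auto
  ultimately have "(\<integral>x\<in>\<Omega>. \<bar>v x\<bar> ^ (N + 2) \<partial>lebesgue) \<le> C * (\<integral>x\<in>\<Omega>. \<bar>v x\<bar> ^ (N + 1) \<partial>lebesgue) / c"
    by (simp add: ennreal_le_iff)
  then show "c * (\<integral>x\<in>\<Omega>. \<bar>v x\<bar> ^ (N + 2) \<partial>lebesgue)
       \<le> (real N + 2)\<^sup>2 / (4 * (real N + 1)) * (\<integral>x\<in>\<Omega>. \<bar>v x\<bar> ^ (N + 1) \<partial>lebesgue)"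
    using P(2) unfolding C_def[symmetric] by (simp add: field_simps)
qed

text \<open>Testing the equation with v itself gives c \<integral> v^2 \<le> \<integral> v \<le> A
  for A = \<integral> |v|. With A^2 \<le> |\<Omega>| \<integral> v^2 this becomes c A^2 \<le>
  |\<Omega>| A, and A cancels unless it is 0.\<close>

lemma torsion_moment_base:
  fixes \<Omega> :: "(real^'m) set"
  assumes \<Omega>: "\<Omega> \<in> sets lebesgue" "emeasure lebesgue \<Omega> < \<infinity>"
    and H: "H01 \<Omega> v G"
    and eq: "\<And>\<phi> K. H01 \<Omega> \<phi> K \<Longrightarrow> (\<integral>x\<in>\<Omega>. G x \<bullet> K x \<partial>lebesgue) = (\<integral>x\<in>\<Omega>. \<phi> x \<partial>lebesgue)"
    and P: "poincare \<Omega> c" "c > 0"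
  shows "set_integrable lebesgue \<Omega> (\<lambda>x. \<bar>v x\<bar>)"
    "c * (\<integral>x\<in>\<Omega>. \<bar>v x\<bar> \<partial>lebesgue) \<le> measure lebesgue \<Omega>"
proof -
  have v2: "sqint lebesgue v" by (rule H01_sqint(1)[OF H])
  note iv = sqint_imp_set_integrable[OF v2 \<Omega>]
  show ia: "set_integrable lebesgue \<Omega> (\<lambda>x. \<bar>v x\<bar>)" by (rule set_integrable_abs[OF iv])
  define A where "A = (\<integral>x\<in>\<Omega>. \<bar>v x\<bar> \<partial>lebesgue)"
  have A0: "A \<ge> 0" unfolding A_def set_lebesgue_integral_def by (intro integral_nonneg_AE) auto
  have "c * (\<integral>x\<in>\<Omega>. (v x)\<^sup>2 \<partial>lebesgue) \<le> (\<integral>x\<in>\<Omega>. (norm (G x))\<^sup>2 \<partial>lebesgue)"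
    using P(1) H unfolding poincare_def by blast
  also have "\<dots> = (\<integral>x\<in>\<Omega>. v x \<partial>lebesgue)"
    using eq[OF H] by (simp add: power2_norm_eq_inner)
  also have "\<dots> \<le> A" unfolding A_def using iv ia by (intro set_integral_mono) auto
  finally have 1: "c * (\<integral>x\<in>\<Omega>. (v x)\<^sup>2 \<partial>lebesgue) \<le> A" .
  have r: "sqint lebesgue (\<lambda>x. indicat_real \<Omega> x *\<^sub>R \<bar>v x\<bar>)"
    using v2 \<Omega>(1) by (intro sqint_restrict) (auto simp: sqint_def)
  have i: "(\<lambda>x. (norm (indicat_real \<Omega> x))\<^sup>2) = indicat_real \<Omega>" by (auto simp: indicator_def)
  have i2: "(\<lambda>x. (norm (indicat_real \<Omega> x *\<^sub>R \<bar>v x\<bar>))\<^sup>2) = (\<lambda>x. indicat_real \<Omega> x *\<^sub>R (v x)\<^sup>2)" by (auto simp: indicator_def)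
  have i3: "(\<lambda>x. indicat_real \<Omega> x \<bullet> (indicat_real \<Omega> x *\<^sub>R \<bar>v x\<bar>)) = (\<lambda>x. indicat_real \<Omega> x *\<^sub>R \<bar>v x\<bar>)" by (auto simp: indicator_def)
  have "A\<^sup>2 \<le> measure lebesgue \<Omega> * (\<integral>x\<in>\<Omega>. (v x)\<^sup>2 \<partial>lebesgue)"
    using sqint_Cauchy_Schwarz[OF sqint_indicator[OF \<Omega>] r] unfolding i i2 i3
    by (simp add: A_def set_lebesgue_integral_def)
  then have "c * A\<^sup>2 \<le> c * (measure lebesgue \<Omega> * (\<integral>x\<in>\<Omega>. (v x)\<^sup>2 \<partial>lebesgue))"
    using P(2) by simp
  also have "\<dots> = measure lebesgue \<Omega> * (c * (\<integral>x\<in>\<Omega>. (v x)\<^sup>2 \<partial>lebesgue))" by simp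
  also have "\<dots> \<le> measure lebesgue \<Omega> * A" by (intro mult_left_mono 1) auto
  finally have 2: "(c * A) * A \<le> measure lebesgue \<Omega> * A" by (simp add: power2_eq_square mult.assoc)
  show "c * (\<integral>x\<in>\<Omega>. \<bar>v x\<bar> \<partial>lebesgue) \<le> measure lebesgue \<Omega>"
  proof (cases "A = 0")
    case False
    with A0 2 show ?thesis unfolding A_def[symmetric] by simp
  qed (simp add: A_def)
qed

text \<open>Integrability is carried through the induction because each step requires it of the
  preceding moment. The index \<open>Suc k\<close> plays the role of n, so the induction starts at
  the first moment with constant 1.\<close>

lemma torsion_moment_bound:
  fixes \<Omega> :: "(real^'m) set"
  assumes \<Omega>: "\<Omega> \<in> sets lebesgue" "emeasure lebesgue \<Omega> < \<infinity>"
    and v: "is_torsion \<Omega> v" and P: "poincare \<Omega> c" "c > 0"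
  shows "set_integrable lebesgue \<Omega> (\<lambda>x. \<bar>v x\<bar> ^ Suc k) \<and>
    c ^ Suc k * (\<integral>x\<in>\<Omega>. \<bar>v x\<bar> ^ Suc k \<partial>lebesgue) \<le> real (Suc k) * fact (Suc k) / 4 ^ k * measure lebesgue \<Omega>"
proof -
  obtain G where H: "H01 \<Omega> v G"
    and eq: "\<And>\<phi> K. H01 \<Omega> \<phi> K \<Longrightarrow> (\<integral>x\<in>\<Omega>. G x \<bullet> K x \<partial>lebesgue) = (\<integral>x\<in>\<Omega>. \<phi> x \<partial>lebesgue)"
    using v unfolding is_torsion_def by blast
  show ?thesis
  proof (induction k)
    case 0
    then show ?case using torsion_moment_base[OF \<Omega> H eq P] by simp
  next
    case (Suc k)
    have int: "set_integrable lebesgue \<Omega> (\<lambda>x. \<bar>v x\<bar> ^ (k + 1))" using Suc by simp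
    note S = torsion_moment_step[OF \<Omega> H eq P int]
    define A B where "A = (\<integral>x\<in>\<Omega>. \<bar>v x\<bar> ^ Suc k \<partial>lebesgue)" and "B = (\<integral>x\<in>\<Omega>. \<bar>v x\<bar> ^ Suc (Suc k) \<partial>lebesgue)"
    have "c ^ Suc (Suc k) * B = c ^ Suc k * (c * B)" by simp
    also have "\<dots> \<le> c ^ Suc k * ((real k + 2)\<^sup>2 / (4 * (real k + 1)) * A)"
      using S(2) P(2) unfolding A_def B_def by (intro mult_left_mono) auto
    also have "\<dots> = (real k + 2)\<^sup>2 / (4 * (real k + 1)) * (c ^ Suc k * A)" by (simp only: mult.left_commute)
    also have "\<dots> \<le> (real k + 2)\<^sup>2 / (4 * (real k + 1)) * (real (Suc k) * fact (Suc k) / 4 ^ k * measure lebesgue \<Omega>)"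
      using Suc unfolding A_def by (intro mult_left_mono) auto
    \<comment> \<open>With n = k + 2 the factor n - 1 cancels, and n^2 (n - 1)! = n n!.\<close>
    also have "\<dots> = real (Suc (Suc k)) * fact (Suc (Suc k)) / 4 ^ Suc k * measure lebesgue \<Omega>"
    proof -
      have "(real k + 2)\<^sup>2 / (4 * (real k + 1)) * (real (Suc k) * fact (Suc k) / 4 ^ k)
          = (real k + 2)\<^sup>2 * fact (Suc k) / (4 * 4 ^ k)"
      proof -
        have "x / (4 * q) * (q * F / r) = x * F / (4 * r)" if "q \<noteq> 0" for q x F r :: real
          using that by simp
        from this[of "real k + 1"] show ?thesis by (simp add: add.commute del: fact_Suc)
      qed
      also have "\<dots> = real (Suc (Suc k)) * fact (Suc (Suc k)) / 4 ^ Suc k"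
        by (subst (2) fact_Suc) (simp add: power2_eq_square algebra_simps del: fact_Suc)
      finally show ?thesis by (metis mult.assoc)
    qed
    finally show ?case using S(1) unfolding B_def by simp
  qed
qed

section \<open>From moments to the functional \<open>F_fun\<close>\<close>

text \<open>\<open>lambda1\<close> excludes null functions by an extended integral but divides by a
  Bochner integral; the two must agree.\<close>

lemma nn_set_integral_sq_eq_set_integral:
  fixes \<phi> :: "'a \<Rightarrow> real"
  assumes "sqint M \<phi>" "A \<in> sets M"
  shows "(\<integral>\<^sup>+x\<in>A. ennreal ((\<phi> x)\<^sup>2) \<partial>M) = ennreal (\<integral>x\<in>A. (\<phi> x)\<^sup>2 \<partial>M)"
proof -
  have "(\<integral>\<^sup>+x\<in>A. ennreal ((\<phi> x)\<^sup>2) \<partial>M) = (\<integral>\<^sup>+x. ennreal (indicator A x *\<^sub>R (\<phi> x)\<^sup>2) \<partial>M)"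
    by (intro nn_integral_cong) (auto simp: indicator_def)
  also have "\<dots> = ennreal (\<integral>x\<in>A. (\<phi> x)\<^sup>2 \<partial>M)"
    using sqint_imp_set_integrable_sq[OF assms] unfolding set_integrable_def set_lebesgue_integral_def
    by (intro nn_integral_eq_integral) auto
  finally show ?thesis .
qed

text \<open>No nonzero test function is constructed. If there were no admissible quotient, every
  element of \<open>H01\<close>, the torsion function included, would vanish almost everywhere on
  \<Omega>, and the functional would be 0 whatever \<open>lambda1\<close> is.\<close>

lemma F_fun_le:
  fixes \<Omega> :: "(real^'m) set"
  assumes op: "open \<Omega>" and pos: "0 < emeasure lebesgue \<Omega>" and fin: "emeasure lebesgue \<Omega> < \<infinity>" and n: "n \<ge> 1"
  shows "F_fun (real n) \<Omega> \<le> (real n * fact n / 4 ^ (n - 1)) powr (1 / real n)"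
proof -
  define S where "S = {(\<integral>x\<in>\<Omega>. (norm (G x))\<^sup>2 \<partial>lebesgue) / (\<integral>x\<in>\<Omega>. (\<phi> x)\<^sup>2 \<partial>lebesgue)
       | \<phi> G. H01 \<Omega> \<phi> G \<and> (\<integral>\<^sup>+x\<in>\<Omega>. ennreal ((\<phi> x)\<^sup>2) \<partial>lebesgue) \<noteq> 0}"
  have l: "lambda1 \<Omega> = Inf S" by (simp add: lambda1_def S_def)
  have \<Omega>: "\<Omega> \<in> sets lebesgue" using op by simp
  have nneg: "0 \<le> (\<integral>x\<in>\<Omega>. (f x)\<^sup>2 \<partial>lebesgue)" for f :: "real^'m \<Rightarrow> real"
    unfolding set_lebesgue_integral_def by (intro integral_nonneg_AE) auto
  have S0: "s \<ge> 0" if "s \<in> S" for s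
    using that nneg by (auto simp: S_def)
  have RHS: "0 \<le> (real n * fact n / 4 ^ (n - 1)) powr (1 / real n)" by simp
  have zero: "(\<integral>x\<in>\<Omega>. (\<phi> x)\<^sup>2 \<partial>lebesgue) = 0"
    if "H01 \<Omega> \<phi> G" "(\<integral>\<^sup>+x\<in>\<Omega>. ennreal ((\<phi> x)\<^sup>2) \<partial>lebesgue) = 0" for \<phi> G
    using that(2) nneg[of \<phi>] unfolding nn_set_integral_sq_eq_set_integral[OF H01_sqint(1)[OF that(1)] \<Omega>]
    by (simp add: ennreal_eq_0_iff)
  show ?thesis
  proof (cases "S = {}")
    case True
    \<comment> \<open>here \<open>lambda1\<close> is the unspecified value \<open>Inf {}\<close>\<close>
    then have all0: "(\<integral>\<^sup>+x\<in>\<Omega>. ennreal ((\<phi> x)\<^sup>2) \<partial>lebesgue) = 0" if "H01 \<Omega> \<phi> G" for \<phi> G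
      using that unfolding S_def by blast
    \<comment> \<open>The left side is identically 0 here, so any positive constant would serve to
      obtain existence.\<close>
    have "poincare \<Omega> 1"
      unfolding poincare_def using zero all0 nneg by simp
    then have "is_torsion \<Omega> (torsion \<Omega>)"
      using torsion_exists[OF \<Omega> fin] unfolding torsion_def by (metis someI_ex zero_less_one)
    then obtain G where H: "H01 \<Omega> (torsion \<Omega>) G" unfolding is_torsion_def by blast
    have [measurable]: "torsion \<Omega> \<in> borel_measurable lebesgue" "\<Omega> \<in> sets lebesgue"
      using H \<Omega> by (auto simp: H01_def)
    have "AE x in lebesgue. ennreal ((torsion \<Omega> x)\<^sup>2) * indicator \<Omega> x = 0"
      using all0[OF H] by (subst (asm) nn_integral_0_iff_AE) auto
    then have "(\<integral>\<^sup>+x\<in>\<Omega>. ennreal (\<bar>torsion \<Omega> x\<bar> powr real n) \<partial>lebesgue) = (\<integral>\<^sup>+x. 0 \<partial>(lebesgue :: (real^'m) measure))"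
      by (intro nn_integral_cong_AE) (auto simp: indicator_def split: if_splits)
    then have "F_fun (real n) \<Omega> = 0" by (simp add: F_fun_def Lp_norm_def)
    then show ?thesis using RHS by simp
  next
    case False
    have l0: "lambda1 \<Omega> \<ge> 0" unfolding l using False S0 by (intro cInf_greatest) auto
    show ?thesis
    proof (cases "lambda1 \<Omega> = 0")
      case True
      then show ?thesis using RHS by (simp add: F_fun_def)
    next
      case False
      define c where "c = lambda1 \<Omega>"
      have c: "c > 0" using False l0 by (simp add: c_def)
      have P: "poincare \<Omega> c"
        unfolding poincare_def
      proof (intro allI impI)
        fix \<phi> G assume H: "H01 \<Omega> \<phi> G"
        show "c * (\<integral>x\<in>\<Omega>. (\<phi> x)\<^sup>2 \<partial>lebesgue) \<le> (\<integral>x\<in>\<Omega>. (norm (G x))\<^sup>2 \<partial>lebesgue)"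
        proof (cases "(\<integral>x\<in>\<Omega>. (\<phi> x)\<^sup>2 \<partial>lebesgue) = 0")
          case True
          then show ?thesis using nneg[of "\<lambda>x. norm (G x)"] by simp
        next
          case False
          then have p: "(\<integral>x\<in>\<Omega>. (\<phi> x)\<^sup>2 \<partial>lebesgue) > 0" using nneg[of \<phi>] by simp
          have "(\<integral>x\<in>\<Omega>. (norm (G x))\<^sup>2 \<partial>lebesgue) / (\<integral>x\<in>\<Omega>. (\<phi> x)\<^sup>2 \<partial>lebesgue) \<in> S"
            unfolding S_def using H False zero by blast
          then have "c \<le> (\<integral>x\<in>\<Omega>. (norm (G x))\<^sup>2 \<partial>lebesgue) / (\<integral>x\<in>\<Omega>. (\<phi> x)\<^sup>2 \<partial>lebesgue)"
            unfolding c_def l using S0 by (intro cInf_lower bdd_belowI[of _ 0]) auto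
          then show ?thesis using p by (simp add: pos_le_divide_eq)
        qed
      qed
      have T: "is_torsion \<Omega> (torsion \<Omega>)"
        using torsion_exists[OF \<Omega> fin c P] unfolding torsion_def by (metis someI_ex)
      obtain k where k: "n = Suc k" using n by (cases n) auto
      define v where "v = torsion \<Omega>"
      define A where "A = (\<integral>x\<in>\<Omega>. \<bar>v x\<bar> ^ n \<partial>lebesgue)"
      define K where "K = real n * fact n / 4 ^ (n - 1)"
      define m where "m = measure lebesgue \<Omega>"
      have m: "m > 0" unfolding m_def measure_def using pos fin by (simp add: enn2real_positive_iff)
      have K: "K \<ge> 0" by (simp add: K_def)
      have B: "set_integrable lebesgue \<Omega> (\<lambda>x. \<bar>v x\<bar> ^ n)" "c ^ n * A \<le> K * m"
        using torsion_moment_bound[OF \<Omega> fin T P c, of k] unfolding A_def v_def k K_def m_def by simp_all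
      have A0: "A \<ge> 0" unfolding A_def set_lebesgue_integral_def by (intro integral_nonneg_AE) auto
      \<comment> \<open>At zeros of \<open>v\<close> this uses \<open>n \<ge> 1\<close>:
        \<open>0 powr 0\<close> is 0 whereas \<open>0 ^ 0\<close> is 1.\<close>
      have "(\<integral>\<^sup>+x\<in>\<Omega>. ennreal (\<bar>v x\<bar> powr real n) \<partial>lebesgue) = (\<integral>\<^sup>+x. ennreal (indicator \<Omega> x *\<^sub>R \<bar>v x\<bar> ^ n) \<partial>lebesgue)"
        using n by (intro nn_integral_cong) (auto simp: indicator_def powr_realpow')
      also have "\<dots> = ennreal A"
        using B(1) unfolding set_integrable_def A_def set_lebesgue_integral_def
        by (intro nn_integral_eq_integral) auto
      finally have Lp: "Lp_norm (real n) \<Omega> v = A powr (1 / real n)"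
        using A0 by (simp add: Lp_norm_def)
      \<comment> \<open>Moves \<open>c\<close> under the n-th root, so that the moment bound can be
        applied to the product.\<close>
      have "c = (c ^ n) powr (1 / real n)"
        using c n by (simp add: powr_realpow[symmetric] powr_powr)
      then have "A powr (1 / real n) * c = (c ^ n * A) powr (1 / real n)"
        by (simp add: powr_mult)
      also have "\<dots> \<le> (K * m) powr (1 / real n)"
        using B(2) A0 c by (intro powr_mono2) auto
      also have "\<dots> = K powr (1 / real n) * m powr (1 / real n)"
        by (rule powr_mult)
      finally have "A powr (1 / real n) * c / m powr (1 / real n) \<le> K powr (1 / real n)"
        using m by (simp add: pos_divide_le_eq)
      then show ?thesis
        unfolding F_fun_def v_def[symmetric] Lp c_def[symmetric] m_def[symmetric] K_def[symmetric] .
    qed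
  qed
qed

theorem theorem3:
  assumes "CARD('m::finite) \<ge> 2"
  shows "(\<forall>n::nat. n \<ge> 1 \<longrightarrow>
           frakF TYPE('m) (real n) \<le> ereal ((real n * fact n / 4 ^ (n - 1)) powr (1 / real n)))
         \<and> frakF TYPE('m) 3 \<le> ereal (3 powr (2/3) / 2)"
proof -
  have *: "frakF TYPE('m) (real n) \<le> ereal ((real n * fact n / 4 ^ (n - 1)) powr (1 / real n))" if "n \<ge> 1" for n
    unfolding frakF_def
  proof (rule Sup_least, clarify)
    fix \<Omega> :: "(real^'m) set"
    assume "open \<Omega>" "0 < emeasure lebesgue \<Omega>" "emeasure lebesgue \<Omega> < \<infinity>"
    from F_fun_le[OF this that]
    show "ereal (F_fun (real n) \<Omega>) \<le> ereal ((real n * fact n / 4 ^ (n - 1)) powr (1 / real n))" by simp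
  qed
  \<comment> \<open>3 * 3! / 4^2 = 9/8, and both sides have this cube.\<close>
  have eq: "(real 3 * fact 3 / 4 ^ (3 - 1)) powr (1 / real 3) = (3 powr (2/3) / 2 :: real)"
  proof -
    have cube_root: "(x ^ 3) powr (1/3) = x" if "x > 0" for x :: real
      using that powr_powr[of x 3 "1/3"] by simp
    have "(3 powr (2/3) / 2 :: real) ^ 3 = 9 / 8"
      by (simp add: power_divide powr_power)
    then have "((3 powr (2/3) / 2 :: real) ^ 3) powr (1/3) = (9 / 8) powr (1/3)" by (simp only:)
    moreover have "((3 powr (2/3) / 2 :: real) ^ 3) powr (1/3) = 3 powr (2/3) / 2"
      by (rule cube_root) simp
    ultimately show ?thesis by (simp add: fact_numeral)
  qed
  have "frakF TYPE('m) 3 \<le> ereal (3 powr (2/3) / 2)"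
    using *[of 3] unfolding eq by simp
  with * show ?thesis by blast
qed

end
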